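(* Let $p$ be an odd prime and $R$ a $p$-torsion-free commutative $\mathbb{Z}_{(p)}$-algebra. Let $i>1$ be an odd integer with $i\in Z_2$. Then $N_{i-2}$ is isomorphic as an $R$-module to $$R/p^{a_i}\oplus R/1\oplus R/3\oplus\cdots\oplus R/(i-2)$$ (the summands after the first being $R/n$ for all odd $n$ with $1\le n\le i-2$).
   Context: For each odd integer $k\ge1$, $N_k:=\mathrm{HC}_{k+1}(R/\!/p)$ is the cyclic homology over $R$ of the dg $R$-algebra $R/\!/p$ (underlying graded algebra $R[x]$, $|x|=1$, $\delta x=p$, so $\delta x^n=p\,x^{n-1}$ for $n$ odd and $0$ for $n$ even). Equivalently, $N_k$ is the colimit of the following diagram of $R$-modules: objects $0$, $R_{-1},R_1,R_3,\dots,R_k$ and $R'_1,R'_3,\dots,R'_{k+2}$, where every $R_j$ and $R'_j$ is a copy of $R$; maps $R'_j\to R_j$ given by multiplication by $j$ for odd $1\le j\le k$, $R'_1\to R_{-1}$ given by multiplication by $p$, $R'_j\to R_{j-2}$ given by multiplication by $p^2$ for odd $3\le j\le k+2$, and $R'_{k+2}\to0$. Define $A_1:=p$ and $A_j:=\frac{p^2A_{j-2}}{j}$ for odd $j\ge3$; $B_0:=1$ and $B_j:=\frac{p^2B_{j-2}}{j}$ for even $j\ge2$. Put $a_j:=\nu_p(A_j)$ and $b_j:=\nu_p(B_j)$, with $\nu_p$ the $p$-adic valuation. For an integer $n\ge1$ divisible by $p$, let $g(n)$ be the maximum even integer $j\geq 0$ with $b_j<\nu_p(n)$. Let $X$ be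 the set of odd positive integers and $X_1\subset X$ those divisible by $p$. Then $Z_2:=X\setminus\bigcup_{n\in X_1}[n-g(n),n+g(n)]$. *)

theory Defs
  imports Complex_Main "HOL-Algebra.Module" "HOL-Algebra.Ideal" "HOL-Computational_Algebra.Primes"
begin

section \<open>Constructions with modules\<close>

text \<open>
  A module over \<open>R\<close> is a record extending \<^typ>\<open>'b ring\<close>; for a plain module the fields
  \<open>mult\<close> and \<open>one\<close> carry no information, and below they are filled with \<^const>\<open>undefined\<close>.
\<close>

definition mod_hom ::
    "('a, 'm) ring_scheme \<Rightarrow> ('a, 'b, 'k) module_scheme \<Rightarrow> ('a, 'c, 'l) module_scheme \<Rightarrow> ('b \<Rightarrow> 'c) set"
  where "mod_hom R M N =
    {f \<in> carrier M \<rightarrow> carrier N.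
       (\<forall>x\<in>carrier M. \<forall>y\<in>carrier M. f (x \<oplus>\<^bsub>M\<^esub> y) = f x \<oplus>\<^bsub>N\<^esub> f y) \<and>
       (\<forall>r\<in>carrier R. \<forall>x\<in>carrier M. f (r \<odot>\<^bsub>M\<^esub> x) = r \<odot>\<^bsub>N\<^esub> f x)}"

definition module_isomorphic ::
    "('a, 'm) ring_scheme \<Rightarrow> ('a, 'b, 'k) module_scheme \<Rightarrow> ('a, 'c, 'l) module_scheme \<Rightarrow> bool"
  where "module_isomorphic R M N \<longleftrightarrow>
    (\<exists>f\<in>mod_hom R M N. bij_betw f (carrier M) (carrier N))"

definition regular_module :: "('a, 'm) ring_scheme \<Rightarrow> ('a, 'a) module"
  where "regular_module R =
    \<lparr>carrier = carrier R, monoid.mult = (\<otimes>\<^bsub>R\<^esub>), one = \<one>\<^bsub>R\<^esub>,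
     zero = \<zero>\<^bsub>R\<^esub>, add = (\<oplus>\<^bsub>R\<^esub>), smult = (\<otimes>\<^bsub>R\<^esub>)\<rparr>"

definition zero_module :: "('a, 'm) ring_scheme \<Rightarrow> ('a, 'a) module"
  where "zero_module R = (regular_module R)\<lparr>carrier := {\<zero>\<^bsub>R\<^esub>}\<rparr>"

definition quotient_module :: "('a, 'b, 'k) module_scheme \<Rightarrow> 'b set \<Rightarrow> ('a, 'b set) module"
  where "quotient_module M H =
    \<lparr>carrier = a_rcosets\<^bsub>M\<^esub> H, monoid.mult = undefined, one = undefined,
     zero = H, add = (\<lambda>C D. C <+>\<^bsub>M\<^esub> D),
     smult = (\<lambda>r C. \<Union>x\<in>C. H +>\<^bsub>M\<^esub> (r \<odot>\<^bsub>M\<^esub> x))\<rparr>"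

definition submodule_span ::
    "('a, 'm) ring_scheme \<Rightarrow> ('a, 'b, 'k) module_scheme \<Rightarrow> 'b set \<Rightarrow> 'b set"
  where "submodule_span R M S = \<Inter>{H. submodule H R M \<and> S \<subseteq> H}"

text \<open>The direct sum of a family of modules over a \<^emph>\<open>finite\<close> index set.\<close>

definition direct_sum :: "'i set \<Rightarrow> ('i \<Rightarrow> ('a, 'b) module) \<Rightarrow> ('a, 'i \<Rightarrow> 'b) module"
  where "direct_sum I M =
    \<lparr>carrier = (\<Pi>\<^sub>E i\<in>I. carrier (M i)), monoid.mult = undefined, one = undefined,
     zero = (\<lambda>i\<in>I. \<zero>\<^bsub>M i\<^esub>), add = (\<lambda>x y. \<lambda>i\<in>I. x i \<oplus>\<^bsub>M i\<^esub> y i),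
     smult = (\<lambda>r x. \<lambda>i\<in>I. r \<odot>\<^bsub>M i\<^esub> x i)\<rparr>"

definition pair_sum :: "('a, 'b, 'k) module_scheme \<Rightarrow> ('a, 'c, 'l) module_scheme \<Rightarrow> ('a, 'b \<times> 'c) module"
  where "pair_sum M N =
    \<lparr>carrier = carrier M \<times> carrier N, monoid.mult = undefined, one = undefined,
     zero = (\<zero>\<^bsub>M\<^esub>, \<zero>\<^bsub>N\<^esub>), add = (\<lambda>(x, y) (x', y'). (x \<oplus>\<^bsub>M\<^esub> x', y \<oplus>\<^bsub>N\<^esub> y')),
     smult = (\<lambda>r (x, y). (r \<odot>\<^bsub>M\<^esub> x, r \<odot>\<^bsub>N\<^esub> y))\<rparr>"

definition cyclic_module :: "('a, 'm) ring_scheme \<Rightarrow> nat \<Rightarrow> ('a, 'a set) module"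
  where "cyclic_module R n = quotient_module (regular_module R) (PIdl\<^bsub>R\<^esub> ([n] \<cdot>\<^bsub>R\<^esub> \<one>\<^bsub>R\<^esub>))"


section \<open>Colimits of finite diagrams of modules\<close>

text \<open>
  A diagram has objects \<open>M i\<close> for \<open>i\<close> in a finite set \<open>I\<close> and a set \<open>E\<close> of maps \<open>(s, t, f)\<close> with
  \<open>f\<close> a homomorphism from \<open>M s\<close> to \<open>M t\<close>. Its colimit is the quotient of the direct sum of the
  objects by the submodule generated by all differences of \<open>x\<close> in the summand \<open>s\<close> and \<open>f x\<close> in
  the summand \<open>t\<close>. The universal property is proved at the end of this section.
\<close>

definition summand_incl :: "'i set \<Rightarrow> ('i \<Rightarrow> ('a, 'b) module) \<Rightarrow> 'i \<Rightarrow> 'b \<Rightarrow> ('i \<Rightarrow> 'b)"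
  where "summand_incl I M i x = (\<lambda>j\<in>I. if j = i then x else \<zero>\<^bsub>M j\<^esub>)"

definition colimit_relations ::
    "('a, 'm) ring_scheme \<Rightarrow> 'i set \<Rightarrow> ('i \<Rightarrow> ('a, 'b) module) \<Rightarrow> ('i \<times> 'i \<times> ('b \<Rightarrow> 'b)) set \<Rightarrow> ('i \<Rightarrow> 'b) set"
  where "colimit_relations R I M E = submodule_span R (direct_sum I M)
    {summand_incl I M t (f x) \<ominus>\<^bsub>direct_sum I M\<^esub> summand_incl I M s x | s t f x.
       (s, t, f) \<in> E \<and> x \<in> carrier (M s)}"

definition colimit ::
    "('a, 'm) ring_scheme \<Rightarrow> 'i set \<Rightarrow> ('i \<Rightarrow> ('a, 'b) module) \<Rightarrow> ('i \<times> 'i \<times> ('b \<Rightarrow> 'b)) set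
      \<Rightarrow> ('a, ('i \<Rightarrow> 'b) set) module"
  where "colimit R I M E = quotient_module (direct_sum I M) (colimit_relations R I M E)"

definition colimit_incl ::
    "('a, 'm) ring_scheme \<Rightarrow> 'i set \<Rightarrow> ('i \<Rightarrow> ('a, 'b) module) \<Rightarrow> ('i \<times> 'i \<times> ('b \<Rightarrow> 'b)) set
      \<Rightarrow> 'i \<Rightarrow> 'b \<Rightarrow> ('i \<Rightarrow> 'b) set"
  where "colimit_incl R I M E i x = colimit_relations R I M E +>\<^bsub>direct_sum I M\<^esub> summand_incl I M i x"

lemma direct_sum_simps [simp]:
  "carrier (direct_sum I M) = (\<Pi>\<^sub>E i\<in>I. carrier (M i))"
  "zero (direct_sum I M) = (\<lambda>i\<in>I. \<zero>\<^bsub>M i\<^esub>)"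
  "add (direct_sum I M) x y = (\<lambda>i\<in>I. x i \<oplus>\<^bsub>M i\<^esub> y i)"
  "smult (direct_sum I M) r x = (\<lambda>i\<in>I. r \<odot>\<^bsub>M i\<^esub> x i)"
  by (simp_all add: direct_sum_def)

lemma module_direct_sum:
  assumes "cring R" and M: "\<And>i. i \<in> I \<Longrightarrow> module R (M i)"
  shows "module R (direct_sum I M)"
proof -
  have ab: "abelian_group (M i)" if "i \<in> I" for i
    using M[OF that] by (simp add: module_def)
  show ?thesis
  proof (rule moduleI)
    show "cring R" by fact
    show "abelian_group (direct_sum I M)"
    proof (rule abelian_groupI; simp)
      fix x assume x: "x \<in> (\<Pi>\<^sub>E i\<in>I. carrier (M i))"
      show "(\<lambda>i\<in>I. (if i \<in> I then \<zero>\<^bsub>M i\<^esub> else undefined) \<oplus>\<^bsub>M i\<^esub> x i) = x"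
      proof
        fix i show "(\<lambda>i\<in>I. (if i \<in> I then \<zero>\<^bsub>M i\<^esub> else undefined) \<oplus>\<^bsub>M i\<^esub> x i) i = x i"
          using x ab[of i] by (auto simp: PiE_iff extensional_def abelian_group_def abelian_monoid.l_zero)
      qed
      show "\<exists>y\<in>\<Pi>\<^sub>E i\<in>I. carrier (M i). (\<lambda>i\<in>I. y i \<oplus>\<^bsub>M i\<^esub> x i) = (\<lambda>i\<in>I. \<zero>\<^bsub>M i\<^esub>)"
        by (rule bexI[of _ "\<lambda>i\<in>I. \<ominus>\<^bsub>M i\<^esub> x i"])
          (use x ab in \<open>auto simp: PiE_iff abelian_group.l_neg abelian_group.a_inv_closed\<close>)
      fix y assume y: "y \<in> (\<Pi>\<^sub>E i\<in>I. carrier (M i))"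
      show "(\<lambda>i\<in>I. x i \<oplus>\<^bsub>M i\<^esub> y i) = (\<lambda>i\<in>I. y i \<oplus>\<^bsub>M i\<^esub> x i)"
        using ab x y by (intro restrict_ext) (auto simp: PiE_iff abelian_group_def intro: abelian_monoid.a_comm)
    qed (use ab in \<open>auto simp: PiE_iff abelian_group_def abelian_monoid.a_closed
          abelian_monoid.zero_closed abelian_monoid.a_assoc intro!: restrict_ext\<close>)
  next
    fix x assume x: "x \<in> carrier (direct_sum I M)"
    show "\<one>\<^bsub>R\<^esub> \<odot>\<^bsub>direct_sum I M\<^esub> x = x"
    proof
      fix i show "(\<one>\<^bsub>R\<^esub> \<odot>\<^bsub>direct_sum I M\<^esub> x) i = x i"
        using x M[of i] by (auto simp: PiE_iff extensional_def module.smult_one)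
    qed
  qed (use module.smult_closed[OF M] module.smult_l_distr[OF M] module.smult_r_distr[OF M]
      module.smult_assoc1[OF M] in \<open>auto simp: PiE_iff intro!: restrict_ext\<close>)
qed

lemma submodule_submodule_span:
  assumes "module R M" and "S \<subseteq> carrier M"
  shows "submodule (submodule_span R M S) R M" and "S \<subseteq> submodule_span R M S"
proof -
  interpret module R M by fact
  have c: "submodule (carrier M) R M" by (rule carrier_is_submodule)
  show "submodule (submodule_span R M S) R M"
  proof (rule submoduleI)
    show "submodule_span R M S \<subseteq> carrier M"
      using c assms(2) by (auto simp: submodule_span_def)
    show "\<zero>\<^bsub>M\<^esub> \<in> submodule_span R M S"
      using subgroup.one_closed submodule.axioms(1) by (fastforce simp: submodule_span_def)
  qed (simp_all add: submodule_span_def submoduleE(3,4,5))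
  show "S \<subseteq> submodule_span R M S" by (auto simp: submodule_span_def)
qed

context
  fixes R :: "('a, 'm) ring_scheme" and M :: "('a, 'b, 'k) module_scheme" and H :: "'b set"
  assumes mod: "module R M" and sub: "submodule H R M"
begin

interpretation module R M by (rule mod)
interpretation S: submodule H R M by (rule sub)
interpretation abelian_subgroup H M
  by (rule abelian_subgroupI3[OF _ M.abelian_group_axioms]) (simp add: additive_subgroup_def S.subgroup_axioms)

lemma quotient_carrierE:
  assumes "C \<in> carrier (quotient_module M H)"
  obtains x where "x \<in> carrier M" "C = H +>\<^bsub>M\<^esub> x"
  using assms by (auto simp: quotient_module_def A_RCOSETS_def')

lemma quotient_simps:
  "zero (quotient_module M H) = H +>\<^bsub>M\<^esub> \<zero>\<^bsub>M\<^esub>"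
  "x \<in> carrier M \<Longrightarrow> H +>\<^bsub>M\<^esub> x \<in> carrier (quotient_module M H)"
  "x \<in> carrier M \<Longrightarrow> y \<in> carrier M \<Longrightarrow>
     (H +>\<^bsub>M\<^esub> x) \<oplus>\<^bsub>quotient_module M H\<^esub> (H +>\<^bsub>M\<^esub> y) = H +>\<^bsub>M\<^esub> (x \<oplus>\<^bsub>M\<^esub> y)"
  "r \<in> carrier R \<Longrightarrow> x \<in> carrier M \<Longrightarrow>
     r \<odot>\<^bsub>quotient_module M H\<^esub> (H +>\<^bsub>M\<^esub> x) = H +>\<^bsub>M\<^esub> (r \<odot>\<^bsub>M\<^esub> x)"
proof -
  show "zero (quotient_module M H) = H +>\<^bsub>M\<^esub> \<zero>\<^bsub>M\<^esub>"
    by (simp add: quotient_module_def a_rcos_const)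
  show "x \<in> carrier M \<Longrightarrow> H +>\<^bsub>M\<^esub> x \<in> carrier (quotient_module M H)" 
    by (auto simp: quotient_module_def A_RCOSETS_def')
  show "x \<in> carrier M \<Longrightarrow> y \<in> carrier M \<Longrightarrow>
     (H +>\<^bsub>M\<^esub> x) \<oplus>\<^bsub>quotient_module M H\<^esub> (H +>\<^bsub>M\<^esub> y) = H +>\<^bsub>M\<^esub> (x \<oplus>\<^bsub>M\<^esub> y)"
    by (simp add: quotient_module_def a_rcos_sum)
  assume r: "r \<in> carrier R" and x: "x \<in> carrier M"
  have "H +>\<^bsub>M\<^esub> (r \<odot>\<^bsub>M\<^esub> y) = H +>\<^bsub>M\<^esub> (r \<odot>\<^bsub>M\<^esub> x)" if y: "y \<in> H +>\<^bsub>M\<^esub> x" for y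
  proof -
    have yc: "y \<in> carrier M" using y x by (rule a_elemrcos_carrier[rotated])
    have "y \<oplus>\<^bsub>M\<^esub> \<ominus>\<^bsub>M\<^esub> x \<in> H" using x y by (rule a_rcos_module_imp)
    then have "r \<odot>\<^bsub>M\<^esub> (y \<oplus>\<^bsub>M\<^esub> \<ominus>\<^bsub>M\<^esub> x) \<in> H" using r by simp
    then have "r \<odot>\<^bsub>M\<^esub> y \<oplus>\<^bsub>M\<^esub> \<ominus>\<^bsub>M\<^esub> (r \<odot>\<^bsub>M\<^esub> x) \<in> H"
      using r x yc by (simp add: smult_r_distr smult_r_minus)
    then have "r \<odot>\<^bsub>M\<^esub> y \<in> H +>\<^bsub>M\<^esub> (r \<odot>\<^bsub>M\<^esub> x)"
      using r x yc by (intro a_rcos_module_rev) auto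
    then show ?thesis using r x by (metis a_repr_independence' smult_closed)
  qed
  moreover have "x \<in> H +>\<^bsub>M\<^esub> x" using x by (rule a_rcos_self)
  ultimately have "(\<Union>y\<in>H +>\<^bsub>M\<^esub> x. H +>\<^bsub>M\<^esub> (r \<odot>\<^bsub>M\<^esub> y)) = H +>\<^bsub>M\<^esub> (r \<odot>\<^bsub>M\<^esub> x)"
    by blast
  then show "r \<odot>\<^bsub>quotient_module M H\<^esub> (H +>\<^bsub>M\<^esub> x) = H +>\<^bsub>M\<^esub> (r \<odot>\<^bsub>M\<^esub> x)"
    by (simp add: quotient_module_def)
qed

lemma quotient_eq_iff:
  assumes "x \<in> carrier M" "y \<in> carrier M"
  shows "H +>\<^bsub>M\<^esub> x = H +>\<^bsub>M\<^esub> y \<longleftrightarrow> x \<ominus>\<^bsub>M\<^esub> y \<in> H"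
  using assms a_rcos_module[of y x] a_rcos_self[of x] a_repr_independence'[of x y]
  by (auto simp: a_minus_def)

lemma module_quotient_module: "module R (quotient_module M H)"
proof (rule moduleI)
  show "abelian_group (quotient_module M H)"
  proof (rule abelian_groupI)
    fix C assume "C \<in> carrier (quotient_module M H)"
    then obtain x where x: "x \<in> carrier M" "C = H +>\<^bsub>M\<^esub> x" by (rule quotient_carrierE)
    show "\<exists>D\<in>carrier (quotient_module M H). D \<oplus>\<^bsub>quotient_module M H\<^esub> C = \<zero>\<^bsub>quotient_module M H\<^esub>"
      by (rule bexI[of _ "H +>\<^bsub>M\<^esub> (\<ominus>\<^bsub>M\<^esub> x)"]) (use x in \<open>auto simp: quotient_simps M.l_neg\<close>)
  qed (auto simp: quotient_simps M.a_ac elim!: quotient_carrierE)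
qed (auto simp: quotient_simps R.is_cring smult_l_distr smult_r_distr smult_assoc1 elim!: quotient_carrierE)

end

theorem colimit_universal_property:
  fixes R :: "('a, 'm) ring_scheme" and M :: "'i \<Rightarrow> ('a, 'b) module"
    and T :: "('a, 'c, 'l) module_scheme"
  assumes R: "cring R" and "finite I" and M: "\<And>i. i \<in> I \<Longrightarrow> module R (M i)"
    and E: "\<And>s t f. (s, t, f) \<in> E \<Longrightarrow> s \<in> I \<and> t \<in> I \<and> f \<in> mod_hom R (M s) (M t)"
  defines "C \<equiv> colimit R I M E" and "inc \<equiv> colimit_incl R I M E"
  shows "module R C"
    and "\<And>i. i \<in> I \<Longrightarrow> inc i \<in> mod_hom R (M i) C"
    and "\<And>s t f x. (s, t, f) \<in> E \<Longrightarrow> x \<in> carrier (M s) \<Longrightarrow> inc t (f x) = inc s x"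
    and "\<And>h. \<lbrakk>module R T; \<And>i. i \<in> I \<Longrightarrow> h i \<in> mod_hom R (M i) T;
           \<And>s t f x. (s, t, f) \<in> E \<Longrightarrow> x \<in> carrier (M s) \<Longrightarrow> h t (f x) = h s x\<rbrakk>
         \<Longrightarrow> \<exists>!u. u \<in> mod_hom R C T \<inter> extensional (carrier C) \<and>
               (\<forall>i\<in>I. \<forall>x\<in>carrier (M i). u (inc i x) = h i x)"
proof -
  let ?D = "direct_sum I M" and ?H = "colimit_relations R I M E" and ?in = "summand_incl I M"
  have D: "module R ?D" using R M by (rule module_direct_sum)
  interpret D: module R ?D by (rule D)
  have abM: "abelian_group (M i)" "abelian_monoid (M i)" if "i \<in> I" for i
    using M[OF that] by (auto simp: module_def abelian_group_def)
  have in_cl: "?in i x \<in> carrier ?D" if "i \<in> I" "x \<in> carrier (M i)" for i x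
    using that abM by (auto simp: summand_incl_def abelian_monoid.zero_closed)
  have in_add: "?in i (x \<oplus>\<^bsub>M i\<^esub> y) = ?in i x \<oplus>\<^bsub>?D\<^esub> ?in i y"
    if "i \<in> I" "x \<in> carrier (M i)" "y \<in> carrier (M i)" for i x y
    using that abM by (auto simp: summand_incl_def abelian_monoid.l_zero abelian_monoid.zero_closed intro!: restrict_ext)
  have in_smult: "?in i (r \<odot>\<^bsub>M i\<^esub> x) = r \<odot>\<^bsub>?D\<^esub> ?in i x"
    if "i \<in> I" "x \<in> carrier (M i)" "r \<in> carrier R" for i r x
    using that module.smult_r_null[OF M] by (auto simp: summand_incl_def intro!: restrict_ext)
  define S where "S = {?in t (f x) \<ominus>\<^bsub>?D\<^esub> ?in s x | s t f x. (s, t, f) \<in> E \<and> x \<in> carrier (M s)}"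
  have fcl: "f x \<in> carrier (M t)" if "(s, t, f) \<in> E" "x \<in> carrier (M s)" for s t f x
    using E[OF that(1)] that(2) by (auto simp: mod_hom_def)
  have S: "S \<subseteq> carrier ?D"
  proof
    fix z assume "z \<in> S"
    then obtain s t f x where e: "(s, t, f) \<in> E" "x \<in> carrier (M s)" and z: "z = ?in t (f x) \<ominus>\<^bsub>?D\<^esub> ?in s x"
      by (auto simp: S_def)
    show "z \<in> carrier ?D" unfolding z using E[OF e(1)] e fcl[OF e]
      by (intro D.minus_closed in_cl) auto
  qed
  have H: "submodule ?H R ?D" and SH: "S \<subseteq> ?H"
    using submodule_submodule_span[OF D S] by (simp_all add: colimit_relations_def S_def)
  note q = quotient_simps[OF D H]
  have C: "C = quotient_module ?D ?H" by (simp add: C_def colimit_def)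
  have inc: "inc i x = ?H +>\<^bsub>?D\<^esub> ?in i x" for i x by (simp add: inc_def colimit_incl_def)
  show mC: "module R C" unfolding C using D H by (rule module_quotient_module)
  interpret C: module R C by (rule mC)
  show inc_hom: "inc i \<in> mod_hom R (M i) C" if i: "i \<in> I" for i
    unfolding mod_hom_def inc C
    using in_cl[OF i] in_add[OF i] in_smult[OF i] by (auto simp del: direct_sum_simps simp: q)
  show "inc t (f x) = inc s x" if e: "(s, t, f) \<in> E" "x \<in> carrier (M s)" for s t f x
  proof -
    have "?in t (f x) \<ominus>\<^bsub>?D\<^esub> ?in s x \<in> ?H" using SH e unfolding S_def by blast
    then show ?thesis unfolding inc
      by (subst quotient_eq_iff[OF D H]) (use E[OF e(1)] e fcl[OF e] in_cl in blast)+
  qed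
  fix h
  assume T: "module R T" and h: "\<And>i. i \<in> I \<Longrightarrow> h i \<in> mod_hom R (M i) T"
    and comm: "\<And>s t f x. (s, t, f) \<in> E \<Longrightarrow> x \<in> carrier (M s) \<Longrightarrow> h t (f x) = h s x"
  interpret T: module R T by (rule T)
  have hcl: "h i x \<in> carrier T" if "i \<in> I" "x \<in> carrier (M i)" for i x
    using h[OF that(1)] that(2) by (auto simp: mod_hom_def)
  have hadd: "h i (x \<oplus>\<^bsub>M i\<^esub> y) = h i x \<oplus>\<^bsub>T\<^esub> h i y"
    if "i \<in> I" "x \<in> carrier (M i)" "y \<in> carrier (M i)" for i x y
    using h[OF that(1)] that(2-) by (auto simp: mod_hom_def)
  have hsm: "h i (r \<odot>\<^bsub>M i\<^esub> x) = r \<odot>\<^bsub>T\<^esub> h i x"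
    if "i \<in> I" "x \<in> carrier (M i)" "r \<in> carrier R" for i r x
    using h[OF that(1)] that(2-) by (auto simp: mod_hom_def)
  have h0: "h i \<zero>\<^bsub>M i\<^esub> = \<zero>\<^bsub>T\<^esub>" if "i \<in> I" for i
  proof -
    have "\<zero>\<^bsub>R\<^esub> \<odot>\<^bsub>M i\<^esub> \<zero>\<^bsub>M i\<^esub> = \<zero>\<^bsub>M i\<^esub>"
      using M[OF that] by (simp add: module.smult_r_null D.R.zero_closed)
    then show ?thesis
      using hsm[OF that, of "\<zero>\<^bsub>M i\<^esub>" "\<zero>\<^bsub>R\<^esub>"] abM[OF that] hcl[OF that, of "\<zero>\<^bsub>M i\<^esub>"]
      by (simp add: abelian_monoid.zero_closed)
  qed
  define v where "v z = (\<Oplus>\<^bsub>T\<^esub>i\<in>I. h i (z i))" for z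
  have mem: "z i \<in> carrier (M i)" if "z \<in> carrier ?D" "i \<in> I" for z i using that by auto
  have vcl: "v z \<in> carrier T" if "z \<in> carrier ?D" for z
    unfolding v_def using mem[OF that] by (intro T.finsum_closed) (auto intro: hcl)
  have vadd: "v (y \<oplus>\<^bsub>?D\<^esub> z) = v y \<oplus>\<^bsub>T\<^esub> v z" if "y \<in> carrier ?D" "z \<in> carrier ?D" for y z
  proof -
    have "v (y \<oplus>\<^bsub>?D\<^esub> z) = (\<Oplus>\<^bsub>T\<^esub>i\<in>I. h i (y i) \<oplus>\<^bsub>T\<^esub> h i (z i))"
      unfolding v_def using mem[OF that(1)] mem[OF that(2)]
      by (intro T.finsum_cong') (auto simp: hadd hcl)
    also have "\<dots> = v y \<oplus>\<^bsub>T\<^esub> v z"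
      unfolding v_def using mem[OF that(1)] mem[OF that(2)] by (intro T.finsum_addf) (auto simp: hcl)
    finally show ?thesis .
  qed
  have vsm: "v (r \<odot>\<^bsub>?D\<^esub> z) = r \<odot>\<^bsub>T\<^esub> v z" if "r \<in> carrier R" "z \<in> carrier ?D" for r z
  proof -
    have "v (r \<odot>\<^bsub>?D\<^esub> z) = (\<Oplus>\<^bsub>T\<^esub>i\<in>I. r \<odot>\<^bsub>T\<^esub> h i (z i))"
      unfolding v_def using mem[OF that(2)] that(1)
      by (intro T.finsum_cong') (auto simp: hsm hcl)
    also have "\<dots> = r \<odot>\<^bsub>T\<^esub> v z"
      unfolding v_def using mem[OF that(2)] that(1) \<open>finite I\<close>
      by (intro T.finsum_smult_ldistr[symmetric]) (auto simp: hcl)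
    finally show ?thesis .
  qed
  have v0: "v \<zero>\<^bsub>?D\<^esub> = \<zero>\<^bsub>T\<^esub>"
    using vsm[of "\<zero>\<^bsub>R\<^esub>" "\<zero>\<^bsub>?D\<^esub>"] vcl[of "\<zero>\<^bsub>?D\<^esub>"] D.M.zero_closed D.R.zero_closed
    by (simp del: direct_sum_simps)
  have vneg: "v (\<ominus>\<^bsub>?D\<^esub> z) = \<ominus>\<^bsub>T\<^esub> v z" if "z \<in> carrier ?D" for z
  proof -
    have "v (\<ominus>\<^bsub>?D\<^esub> z) \<oplus>\<^bsub>T\<^esub> v z = v (\<ominus>\<^bsub>?D\<^esub> z \<oplus>\<^bsub>?D\<^esub> z)"
      by (rule vadd[symmetric]) (use that in \<open>simp_all del: direct_sum_simps\<close>)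
    also have "\<dots> = \<zero>\<^bsub>T\<^esub>" using v0 that by (simp del: direct_sum_simps add: D.M.l_neg)
    finally show ?thesis using vcl that D.M.a_inv_closed by (metis T.M.minus_equality)
  qed
  have vin: "v (?in i x) = h i x" if "i \<in> I" "x \<in> carrier (M i)" for i x
  proof -
    have "v (?in i x) = (\<Oplus>\<^bsub>T\<^esub>j\<in>I. if i = j then h j x else \<zero>\<^bsub>T\<^esub>)"
      unfolding v_def using that h0 hcl by (intro T.finsum_cong') (auto simp: summand_incl_def)
    also have "\<dots> = h i x"
    proof -
      have "(\<Oplus>\<^bsub>T\<^esub>j\<in>I. if i = j then (if j = i then h i x else \<zero>\<^bsub>T\<^esub>) else \<zero>\<^bsub>T\<^esub>) = (if i = i then h i x else \<zero>\<^bsub>T\<^esub>)"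
        by (rule T.finsum_singleton) (use that hcl \<open>finite I\<close> in auto)
      moreover have "(\<lambda>j. if i = j then (if j = i then h i x else \<zero>\<^bsub>T\<^esub>) else \<zero>\<^bsub>T\<^esub>) = (\<lambda>j. if i = j then h j x else \<zero>\<^bsub>T\<^esub>)"
        by auto
      ultimately show ?thesis by simp
    qed
    finally show ?thesis .
  qed
  define K where "K = {z \<in> carrier ?D. v z = \<zero>\<^bsub>T\<^esub>}"
  have "submodule K R ?D"
    by (rule D.submoduleI)
      (auto simp del: direct_sum_simps simp: K_def v0 vneg vadd vsm)
  moreover have "S \<subseteq> K"
  proof
    fix z assume zS: "z \<in> S"
    then obtain s t f x where e: "(s, t, f) \<in> E" "x \<in> carrier (M s)" and z: "z = ?in t (f x) \<ominus>\<^bsub>?D\<^esub> ?in s x"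
      by (auto simp: S_def)
    have c: "?in t (f x) \<in> carrier ?D" "?in s x \<in> carrier ?D"
      using E[OF e(1)] e fcl[OF e] in_cl by blast+
    have "v z = h t (f x) \<oplus>\<^bsub>T\<^esub> \<ominus>\<^bsub>T\<^esub> h s x"
      unfolding z a_minus_def using E[OF e(1)] e fcl[OF e] c
      by (simp del: direct_sum_simps add: vadd vneg vin)
    also have "\<dots> = \<zero>\<^bsub>T\<^esub>"
      using comm[OF e] E[OF e(1)] e hcl by (simp add: T.M.r_neg)
    finally show "z \<in> K" using zS S by (auto simp: K_def)
  qed
  ultimately have HK: "?H \<subseteq> K" by (auto simp: colimit_relations_def submodule_span_def S_def)
  have wd: "v y = v z" if "y \<in> carrier ?D" "z \<in> carrier ?D" "?H +>\<^bsub>?D\<^esub> y = ?H +>\<^bsub>?D\<^esub> z" for y z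
  proof -
    have "y \<ominus>\<^bsub>?D\<^esub> z \<in> K" using quotient_eq_iff[OF D H that(1,2)] that(3) HK by auto
    then have "v y \<oplus>\<^bsub>T\<^esub> \<ominus>\<^bsub>T\<^esub> v z = \<zero>\<^bsub>T\<^esub>"
      using that by (simp del: direct_sum_simps add: K_def a_minus_def vadd vneg)
    then show ?thesis using vcl that T.M.minus_equality[of "v y" "\<ominus>\<^bsub>T\<^esub> v z"] by simp
  qed
  define u where "u = (\<lambda>c\<in>carrier C. v (SOME z. z \<in> carrier ?D \<and> c = ?H +>\<^bsub>?D\<^esub> z))"
  have u: "u (?H +>\<^bsub>?D\<^esub> z) = v z" if z: "z \<in> carrier ?D" for z
  proof -
    let ?P = "\<lambda>y. y \<in> carrier ?D \<and> ?H +>\<^bsub>?D\<^esub> z = ?H +>\<^bsub>?D\<^esub> y"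
    have y: "?P (SOME y. ?P y)" by (rule someI[of ?P z]) (rule conjI[OF z refl])
    have "v (SOME y. ?P y) = v z" by (rule wd[OF conjunct1[OF y] z conjunct2[OF y, symmetric]])
    moreover have "?H +>\<^bsub>?D\<^esub> z \<in> carrier C" unfolding C by (rule q(2)[OF z])
    ultimately show ?thesis by (simp only: u_def restrict_apply if_True)
  qed
  show "\<exists>!u. u \<in> mod_hom R C T \<inter> extensional (carrier C) \<and>
               (\<forall>i\<in>I. \<forall>x\<in>carrier (M i). u (inc i x) = h i x)"
  proof (rule ex1I[of _ u])
    have "u \<in> mod_hom R C T"
      unfolding mod_hom_def C
      by (auto simp del: direct_sum_simps elim!: quotient_carrierE[OF D H] simp: q u vcl vadd vsm)
    moreover have "u \<in> extensional (carrier C)" by (simp add: u_def)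
    ultimately show "u \<in> mod_hom R C T \<inter> extensional (carrier C) \<and>
               (\<forall>i\<in>I. \<forall>x\<in>carrier (M i). u (inc i x) = h i x)"
      using in_cl vin by (auto simp del: direct_sum_simps simp: inc u)
  next
    fix w assume w: "w \<in> mod_hom R C T \<inter> extensional (carrier C) \<and>
               (\<forall>i\<in>I. \<forall>x\<in>carrier (M i). w (inc i x) = h i x)"
    define part where "part J z = (\<lambda>i\<in>I. if i \<in> J then z i else \<zero>\<^bsub>M i\<^esub>)" for J z
    have part_cl: "part J z \<in> carrier ?D" if "z \<in> carrier ?D" for J z
      using that abM by (auto simp: part_def PiE_iff abelian_monoid.zero_closed)
    have wadd: "w (c \<oplus>\<^bsub>C\<^esub> d) = w c \<oplus>\<^bsub>T\<^esub> w d" if "c \<in> carrier C" "d \<in> carrier C" for c d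
      using w that by (auto simp: mod_hom_def)
    have wcl: "w c \<in> carrier T" if "c \<in> carrier C" for c
      using w that by (auto simp: mod_hom_def)
    have w0: "w \<zero>\<^bsub>C\<^esub> = \<zero>\<^bsub>T\<^esub>"
      using wadd[of "\<zero>\<^bsub>C\<^esub>" "\<zero>\<^bsub>C\<^esub>"] wcl[of "\<zero>\<^bsub>C\<^esub>"] by simp
    have key: "w (?H +>\<^bsub>?D\<^esub> part J z) = v (part J z)"
      if z: "z \<in> carrier ?D" and J: "J \<subseteq> I" for J z
      using finite_subset[OF J \<open>finite I\<close>] J
    proof (induction J rule: finite_induct)
      case empty
      have "part {} z = \<zero>\<^bsub>?D\<^esub>" by (simp add: part_def)
      then show ?case using w0 v0 q(1) by (simp del: direct_sum_simps add: C)
    next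
      case (insert j J)
      have zj: "z j \<in> carrier (M j)" "j \<in> I" using z insert.prems by auto
      have eq: "part (insert j J) z = ?in j (z j) \<oplus>\<^bsub>?D\<^esub> part J z"
        using insert.hyps z abM
        by (auto simp: part_def summand_incl_def PiE_iff abelian_monoid.l_zero abelian_monoid.r_zero
            abelian_monoid.zero_closed intro!: restrict_ext)
      have "w (?H +>\<^bsub>?D\<^esub> part (insert j J) z) = w (inc j (z j) \<oplus>\<^bsub>C\<^esub> (?H +>\<^bsub>?D\<^esub> part J z))"
        using zj part_cl[OF z] in_cl by (simp del: direct_sum_simps add: eq q C inc)
      also have "\<dots> = h j (z j) \<oplus>\<^bsub>T\<^esub> v (part J z)"
        using zj part_cl[OF z] in_cl insert w
        by (subst wadd) (auto simp del: direct_sum_simps simp: inc C q)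
      also have "\<dots> = v (part (insert j J) z)"
        using zj part_cl[OF z] in_cl by (simp del: direct_sum_simps add: eq vadd vin)
      finally show ?case .
    qed
    have "w c = u c" if c: "c \<in> carrier C" for c
    proof -
      obtain z where z: "z \<in> carrier ?D" "c = ?H +>\<^bsub>?D\<^esub> z"
        using c unfolding C by (rule quotient_carrierE[OF D H])
      have "part I z = z" using z(1) by (auto simp: part_def PiE_iff extensional_def)
      then show ?thesis using key[OF z(1), of I] u[OF z(1)] z(2) by simp
    qed
    then show "w = u" using w by (intro extensionalityI[of _ "carrier C"]) (auto simp: u_def)
  qed
qed

section \<open>The modules \<open>N\<^sub>k\<close>\<close>

text \<open>
  For odd \<open>k \<ge> 1\<close>, \<open>N\<^sub>k\<close> is the cyclic homology \<open>HC\<^bsub>k+1\<^esub>(R//p)\<close>, described here by its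
  presentation as a colimit. \<open>Plain j\<close> and \<open>Primed j\<close> index the copies \<open>R\<^sub>j\<close> and \<open>R'\<^sub>j\<close> of \<open>R\<close>,
  and \<open>Null\<close> indexes the zero module.
\<close>

datatype node = Null | Plain int | Primed int

definition N_nodes :: "nat \<Rightarrow> node set"
  where "N_nodes k =
    {Null} \<union> {Plain j | j. odd j \<and> -1 \<le> j \<and> j \<le> int k} \<union>
    {Primed j | j. odd j \<and> 1 \<le> j \<and> j \<le> int k + 2}"

fun N_object :: "('a, 'm) ring_scheme \<Rightarrow> node \<Rightarrow> ('a, 'a) module"
  where
    "N_object R Null = zero_module R"
  | "N_object R (Plain j) = regular_module R"
  | "N_object R (Primed j) = regular_module R"

definition N_arrows :: "('a, 'm) ring_scheme \<Rightarrow> nat \<Rightarrow> nat \<Rightarrow> (node \<times> node \<times> ('a \<Rightarrow> 'a)) set"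
  where "N_arrows R p k =
    {(Primed j, Plain j, \<lambda>x. [j] \<cdot>\<^bsub>R\<^esub> x) | j. odd j \<and> 1 \<le> j \<and> j \<le> int k} \<union>
    {(Primed 1, Plain (-1), \<lambda>x. [p] \<cdot>\<^bsub>R\<^esub> x)} \<union>
    {(Primed j, Plain (j - 2), \<lambda>x. [p\<^sup>2] \<cdot>\<^bsub>R\<^esub> x) | j. odd j \<and> 3 \<le> j \<and> j \<le> int k + 2} \<union>
    {(Primed (int k + 2), Null, \<lambda>x. \<zero>\<^bsub>R\<^esub>)}"

definition N_module :: "('a, 'm) ring_scheme \<Rightarrow> nat \<Rightarrow> nat \<Rightarrow> ('a, (node \<Rightarrow> 'a) set) module"
  where "N_module R p k = colimit R (N_nodes k) (N_object R) (N_arrows R p k)"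


lemma N_diagram:
  fixes R :: "('a, 'm) ring_scheme"
  assumes R: "cring R" and k: "odd k"
  shows "finite (N_nodes k)" and "\<And>v. module R (N_object R v)"
    and "\<And>s t f. (s, t, f) \<in> N_arrows R p k \<Longrightarrow>
           s \<in> N_nodes k \<and> t \<in> N_nodes k \<and> f \<in> mod_hom R (N_object R s) (N_object R t)"
proof -
  interpret cring R by (rule R)
  have "finite ({Null} \<union> Plain ` {-1..int k} \<union> Primed ` {1..int k + 2})" by simp
  then show "finite (N_nodes k)" by (rule finite_subset[rotated]) (auto simp: N_nodes_def)
  have reg: "module R (regular_module R)"
  proof (rule moduleI)
    show "abelian_group (regular_module R)"
      by (rule abelian_groupI) (auto simp: regular_module_def a_ac intro!: bexI[of _ "\<ominus>\<^bsub>R\<^esub> x" for x] l_neg)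
  qed (auto simp: regular_module_def R l_distr r_distr m_assoc)
  have zero: "module R (zero_module R)"
  proof (rule moduleI)
    show "abelian_group (zero_module R)"
      by (rule abelian_groupI) (auto simp: zero_module_def regular_module_def)
  qed (auto simp: zero_module_def regular_module_def R)
  show "module R (N_object R v)" for v using reg zero by (cases v) auto
  have int_hom: "(\<lambda>x. [j] \<cdot>\<^bsub>R\<^esub> x) \<in> mod_hom R (regular_module R) (regular_module R)" for j :: int
    by (auto simp: mod_hom_def regular_module_def add.int_pow_distrib add_pow_rdistr_int)
  have nat_hom: "(\<lambda>x. [n] \<cdot>\<^bsub>R\<^esub> x) \<in> mod_hom R (regular_module R) (regular_module R)" for n :: nat
    by (auto simp: mod_hom_def regular_module_def add.nat_pow_distrib add_pow_rdistr)
  show "s \<in> N_nodes k \<and> t \<in> N_nodes k \<and> f \<in> mod_hom R (N_object R s) (N_object R t)"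
    if "(s, t, f) \<in> N_arrows R p k" for s t f
    using that k int_hom nat_hom
    by (auto simp: N_arrows_def N_nodes_def mod_hom_def zero_module_def regular_module_def)
qed


section \<open>Arithmetic data\<close>

definition localized_integers :: "nat \<Rightarrow> rat ring"
  where "localized_integers p =
    \<lparr>carrier = {of_int a / of_int b | a b. \<not> int p dvd b}, monoid.mult = (*), one = 1, zero = 0, add = (+)\<rparr>"

definition p_valuation :: "nat \<Rightarrow> rat \<Rightarrow> int"
  where "p_valuation p q =
    int (multiplicity (int p) (fst (quotient_of q))) - int (multiplicity (int p) (snd (quotient_of q)))"

text \<open>\<open>A_num\<close> is only meaningful at odd and \<open>B_num\<close> only at even arguments; the other values are dummies.\<close>

fun A_num :: "nat \<Rightarrow> nat \<Rightarrow> rat"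
  where
    "A_num p 0 = 0"
  | "A_num p (Suc 0) = of_nat p"
  | "A_num p (Suc (Suc j)) = (of_nat p)\<^sup>2 * A_num p j / of_nat (Suc (Suc j))"

fun B_num :: "nat \<Rightarrow> nat \<Rightarrow> rat"
  where
    "B_num p 0 = 1"
  | "B_num p (Suc 0) = 0"
  | "B_num p (Suc (Suc j)) = (of_nat p)\<^sup>2 * B_num p j / of_nat (Suc (Suc j))"

text \<open>
  For odd \<open>j\<close> one has \<open>A_num p j = p ^ j / (1 * 3 * ... * j)\<close>, so \<open>a_val p j > 0\<close> and the exponent
  \<open>nat (a_val p j)\<close> is not truncated.
\<close>

definition a_val :: "nat \<Rightarrow> nat \<Rightarrow> int"
  where "a_val p j = p_valuation p (A_num p j)"

definition b_val :: "nat \<Rightarrow> nat \<Rightarrow> int"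
  where "b_val p j = p_valuation p (B_num p j)"

text \<open>
  For \<open>p dvd n\<close> and \<open>n > 0\<close> the set below contains \<open>0\<close>; for an odd prime \<open>p\<close> it is finite because
  \<open>b_val p j \<ge> j / 2\<close> for even \<open>j\<close>.
\<close>

definition g_radius :: "nat \<Rightarrow> nat \<Rightarrow> nat"
  where "g_radius p n = Max {j. even j \<and> b_val p j < p_valuation p (of_nat n)}"

definition Z2 :: "nat \<Rightarrow> int set"
  where "Z2 p = {m. odd m \<and> m > 0} -
    (\<Union>n\<in>{n. odd n \<and> p dvd n}. {int n - int (g_radius p n)..int n + int (g_radius p n)})"

end

theory Submission
  imports Defs
begin

text \<open>
  Put \<open>i = 2 r + 1\<close> and \<open>k = i - 2\<close>. Eliminating the primed copies, \<open>N\<^sub>k\<close> is generated by elements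
  \<open>e\<close> and \<open>E\<^sub>1, E\<^sub>3, \<dots>, E\<^sub>k\<close> (the images of \<open>1\<close> in \<open>R\<^bsub>-1\<^esub>\<close> and in \<open>R\<^sub>1, R\<^sub>3, \<dots>, R\<^sub>k\<close>) subject to
  \<open>E\<^sub>1 = p e\<close>, \<open>n E\<^sub>n = p\<^sup>2 E\<^bsub>n-2\<^esub>\<close> for odd \<open>3 \<le> n \<le> k\<close>, and \<open>p\<^sup>2 E\<^sub>k = 0\<close>. New generators
  \<open>W\<^sub>1, W\<^sub>3, \<dots>, W\<^sub>k\<close> are introduced by the unitriangular system
    \<open>E\<^sub>n = A\<^sub>n e + \<Sum>\<^bsub>m\<le>n\<^esub> B\<^bsub>n-m\<^esub> W\<^sub>m\<close> (\<open>m\<close> odd),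
  whose coefficients lie in the localization of the integers at \<open>p\<close>.

  The multiples \<open>A\<^sub>n e\<close> satisfy the relation \<open>n (A\<^sub>n e) = p\<^sup>2 (A\<^bsub>n-2\<^esub> e)\<close> by themselves. If \<open>m W\<^sub>m = 0\<close>, then
  \<open>n\<close> acts on \<open>W\<^sub>m\<close> as \<open>n - m\<close>, and \<open>(n - m) B\<^bsub>n-m\<^esub> = p\<^sup>2 B\<^bsub>n-2-m\<^esub>\<close>. Hence, inductively, the relations for
  \<open>E\<^sub>1, \<dots>, E\<^sub>k\<close> say exactly that \<open>n W\<^sub>n = 0\<close> for all odd \<open>n \<le> k\<close>. The same computation with \<open>i\<close> in
  place of \<open>n\<close> rewrites the last relation as
    \<open>0 = p\<^sup>2 E\<^sub>k = i (A\<^sub>i e + \<Sum>\<^bsub>n\<le>k\<^esub> B\<^bsub>i-n\<^esub> W\<^sub>n)\<close>.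
  Membership of \<open>i\<close> in \<^const>\<open>Z2\<close> implies that \<open>p\<close> does not divide \<open>i\<close> and that \<open>B\<^bsub>i-n\<^esub>\<close> is divisible by
  \<open>n\<close> locally at \<open>p\<close>, so that all terms of the sum vanish and \<open>A\<^sub>i e = 0\<close> remains. As \<open>A\<^sub>i\<close> is a unit
  times \<open>p\<close> to the power \<open>a_val p i\<close>, the elements \<open>e\<close> and \<open>W\<^sub>n\<close> split \<open>N\<^sub>k\<close> into the desired cyclic
  summands.

  The equivalence of the two systems of relations, \<open>chain_relations_iff_torsion_relations\<close>, is
  proved for elements of an arbitrary module. Both \<open>N\<^sub>k\<close> and the direct sum of cyclic modules are
  universal among modules with elements satisfying the respective system, and so the equivalence
  yields mutually inverse homomorphisms (\<open>N_module_isomorphic_torsion_sum\<close>).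
\<close>

section \<open>Valuations of the coefficients\<close>

text \<open>Legendre's formula, one step at a time: among the factors of \<open>n!\<close> exactly the multiples of \<open>p\<close>
  contribute, and dividing each of them by \<open>p\<close> leaves \<open>(n div p)!\<close>.\<close>

lemma multiplicity_fact_step:
  fixes p n :: nat
  assumes p: "Factorial_Ring.prime p"
  shows "multiplicity p (fact n) = n div p + multiplicity p (fact (n div p))"
proof (induction n)
  case (Suc n)
  have mult: "multiplicity p (a * b) = multiplicity p a + multiplicity p b"
    if "a \<noteq> 0" "b \<noteq> 0" for a b :: nat
    using that p by (intro prime_elem_multiplicity_mult_distrib) auto
  have fact_Suc': "multiplicity p (fact (Suc m)) = multiplicity p (Suc m) + multiplicity p (fact m)" for m
    using mult[of "Suc m" "fact m"] by simp
  have p1: "p > 1" using p prime_gt_1_nat by blast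
  show ?case
  proof (cases "p dvd Suc n")
    case True
    then obtain c where c: "Suc n = p * c" by (auto elim: dvdE)
    then obtain d where d: "c = Suc d" by (cases c) auto
    \<comment> \<open>The quotient jumps exactly when \<open>Suc n\<close> is a multiple of \<open>p\<close>.\<close>
    have n: "n = p * d + (p - 1)" using c d p1 by simp
    have "n div p = d" unfolding n using p1 by (subst div_mult_self4) auto
    moreover have "Suc n div p = Suc d" using c d p1 by simp
    moreover have "multiplicity p (Suc n) = 1 + multiplicity p (Suc d)"
      using mult[of p "Suc d"] p1 c d by (simp add: multiplicity_self)
    ultimately show ?thesis using Suc fact_Suc'[of n] fact_Suc'[of d] by simp
  next
    case False
    then have "Suc n div p = n div p" by (simp add: div_Suc dvd_eq_mod_eq_0)
    then show ?thesis using Suc fact_Suc'[of n] False by (simp add: not_dvd_imp_multiplicity_0)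
  qed
qed simp

lemma multiplicity_fact_le:
  fixes p n :: nat
  assumes p: "Factorial_Ring.prime p"
  shows "multiplicity p (fact n) \<le> n"
proof (induction n rule: less_induct)
  case (less n)
  show ?case
  proof (cases "n = 0")
    case False
    have p2: "2 \<le> p" using p by (rule prime_ge_2_nat)
    have "n div p < n" using False p2 by simp
    then have "multiplicity p (fact n) \<le> 2 * (n div p)"
      using less multiplicity_fact_step[OF p, of n] by fastforce
    also have "\<dots> \<le> p * (n div p)" using p2 by simp
    finally show ?thesis using times_div_less_eq_dividend[of p n] by linarith
  qed simp
qed

text \<open>The valuation is defined from the reduced fraction; this frees it from that choice, after which
  multiplicativity is immediate.\<close>

lemma p_valuation_fraction:
  assumes p: "Factorial_Ring.prime p" and "a \<noteq> 0" "b \<noteq> 0"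
  shows "p_valuation p (of_int a / of_int b) =
    int (multiplicity (int p) a) - int (multiplicity (int p) b)"
proof -
  obtain c d where cd: "quotient_of (of_int a / of_int b) = (c, d)" by force
  have d: "d > 0" using cd by (rule quotient_of_denom_pos)
  have eq: "of_int a / of_int b = (of_int c / of_int d :: rat)" using cd by (rule quotient_of_div)
  then have "of_int a * of_int d = (of_int c * of_int b :: rat)"
    using d assms by (simp add: field_simps)
  then have ad: "a * d = c * b" by (metis of_int_eq_iff of_int_mult)
  then have c: "c \<noteq> 0" using d assms by auto
  have "prime_elem (int p)" using p by simp
  then have "multiplicity (int p) a + multiplicity (int p) d = multiplicity (int p) c + multiplicity (int p) b"
    using ad c d assms by (metis less_numeral_extra(3) prime_elem_multiplicity_mult_distrib)
  then show ?thesis by (simp add: p_valuation_def cd)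
qed

lemma p_valuation_mult:
  assumes p: "Factorial_Ring.prime p" and "x \<noteq> 0" "y \<noteq> 0"
  shows "p_valuation p (x * y) = p_valuation p x + p_valuation p y"
proof -
  obtain a b where x: "x = of_int a / of_int b" "b \<noteq> 0" by (metis quotient_of_div quotient_of_denom_pos surj_pair less_irrefl)
  obtain c d where y: "y = of_int c / of_int d" "d \<noteq> 0" by (metis quotient_of_div quotient_of_denom_pos surj_pair less_irrefl)
  have nz: "a \<noteq> 0" "c \<noteq> 0" using x y assms by auto
  have pe: "prime_elem (int p)" using p by simp
  have "x * y = of_int (a * c) / of_int (b * d)" using x y by simp
  then have "p_valuation p (x * y) = int (multiplicity (int p) (a * c)) - int (multiplicity (int p) (b * d))"
    using p_valuation_fraction[OF p, of "a * c" "b * d"] nz x y by simp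
  then show ?thesis
    using p_valuation_fraction[OF p nz(1) x(2)] p_valuation_fraction[OF p nz(2) y(2)] nz x y
    by (simp add: prime_elem_multiplicity_mult_distrib[OF pe])
qed

lemma p_valuation_of_nat:
  assumes p: "Factorial_Ring.prime p"
  shows "p_valuation p (of_nat n) = int (multiplicity p n)"
proof (cases "n = 0")
  case False
  have np: "\<not> is_unit p" using p by (simp add: prime_nat_iff)
  have dvd: "int p ^ k dvd int n \<longleftrightarrow> p ^ k dvd n" for k
    by (metis int_dvd_int_iff of_nat_power)
  have "\<not> p ^ Suc (multiplicity p n) dvd n"
    unfolding power_dvd_iff_le_multiplicity[OF False np] by simp
  then have "multiplicity (int p) (int n) = multiplicity p n"
    using multiplicity_dvd[of p n] unfolding dvd[symmetric] by (intro multiplicity_eqI)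
  then show ?thesis by (simp add: p_valuation_def)
qed (simp add: p_valuation_def)

lemma localized_integersI:
  assumes p: "Factorial_Ring.prime p" and v: "p_valuation p q \<ge> 0"
  shows "q \<in> carrier (localized_integers p)"
proof -
  obtain c d where cd: "quotient_of q = (c, d)" by force
  have "\<not> int p dvd d"
  proof
    assume pd: "int p dvd d"
    have "coprime c d" using cd by (rule quotient_of_coprime)
    then have "\<not> int p dvd c" using pd p by (auto dest: coprime_common_divisor)
    moreover have "d \<noteq> 0" using quotient_of_denom_pos[OF cd] by simp
    moreover have "\<not> is_unit (int p)" using p by (simp add: prime_nat_iff)
    ultimately show False using v cd pd 
      by (auto simp: p_valuation_def not_dvd_imp_multiplicity_0 multiplicity_eq_zero_iff)
  qed
  then show ?thesis using quotient_of_div[OF cd] by (auto simp: localized_integers_def)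
qed

text \<open>\<open>A_num p (2 s + 1)\<close> is \<open>p\<^bsup>2s+1\<^esup> / (1 \<cdot> 3 \<dots> (2 s + 1))\<close>; multiplying numerator and denominator by
  \<open>2 \<cdot> 4 \<dots> (2 s)\<close> turns the denominator into a factorial, for which the bound above is available.\<close>

lemma A_num_fact: "A_num p (2 * s + 1) * of_nat (fact (2 * s + 1)) = of_nat (p ^ (2 * s + 1) * 2 ^ s * fact s)"
proof (induction s)
  case (Suc s)
  have step: "A_num p (Suc (Suc j)) * of_nat (fact (Suc (Suc j))) =
      of_nat p ^ 2 * of_nat (Suc j) * (A_num p j * of_nat (fact j))" for j
  proof -
    have "of_nat (fact (Suc (Suc j))) = (of_nat (Suc (Suc j)) * of_nat (Suc j) * of_nat (fact j) :: rat)"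
      by (simp only: fact_Suc of_nat_mult of_nat_id mult.assoc)
    moreover have "of_nat (Suc (Suc j)) \<noteq> (0 :: rat)" by (simp only: of_nat_eq_0_iff)
    ultimately show ?thesis by (simp add: A_num.simps(3) del: of_nat_Suc fact_Suc)
  qed
  have "A_num p (2 * Suc s + 1) * of_nat (fact (2 * Suc s + 1)) =
      of_nat p ^ 2 * of_nat (2 * Suc s) * of_nat (p ^ (2 * s + 1) * 2 ^ s * fact s)"
    using step[of "2 * s + 1"] Suc by (simp only: mult_Suc_right add_Suc add_Suc_right add_2_eq_Suc add_2_eq_Suc' One_nat_def add_0_right)
  also have "\<dots> = of_nat (p ^ 2 * (2 * Suc s) * (p ^ (2 * s + 1) * 2 ^ s * fact s))"
    by (simp only: of_nat_mult of_nat_power)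
  also have "p ^ 2 * (2 * Suc s) * (p ^ (2 * s + 1) * 2 ^ s * fact s) = p ^ (2 * Suc s + 1) * 2 ^ Suc s * fact (Suc s)"
  proof -
    have "p ^ (2 * Suc s + 1) = p ^ 2 * p ^ (2 * s + 1)" by (simp flip: power_add)
    then show ?thesis by (simp only: fact_Suc power_Suc[of 2 s] of_nat_id ac_simps)
  qed
  finally show ?case .
qed simp

lemma B_num_fact: "B_num p (2 * m) * of_nat (2 ^ m * fact m) = of_nat (p ^ (2 * m))"
proof (induction m)
  case (Suc m)
  have "B_num p (2 * Suc m) * of_nat (2 ^ Suc m * fact (Suc m)) =
      of_nat p ^ 2 * (B_num p (2 * m) * of_nat (2 ^ m * fact m))"
    by (simp add: field_simps)
  also have "\<dots> = of_nat (p ^ (2 * Suc m))" unfolding Suc by (simp add: power2_eq_square)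
  finally show ?case .
qed simp

context
  fixes p :: nat
  assumes p: "Factorial_Ring.prime p" "odd p"
begin

lemma A_num_nonzero: "A_num p (2 * s + 1) \<noteq> 0"
  using A_num_fact[of p s] prime_gt_0_nat[OF p(1)] by auto

lemma B_num_nonzero: "B_num p (2 * m) \<noteq> 0"
  using B_num_fact[of p m] prime_gt_0_nat[OF p(1)] by auto

lemma a_val_nonneg: "a_val p (2 * s + 1) \<ge> 0"
proof -
  have "multiplicity p (p ^ (2 * s + 1) * 2 ^ s * fact s) \<ge> multiplicity p (p ^ (2 * s + 1))"
    using p by (intro dvd_imp_multiplicity_le) (auto simp: prime_gt_0_nat)
  moreover have "multiplicity p (p ^ (2 * s + 1)) = 2 * s + 1"
    using p(1) by (intro multiplicity_same_power) (auto simp: prime_nat_iff)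
  moreover have "a_val p (2 * s + 1) + int (multiplicity p (fact (2 * s + 1))) =
      int (multiplicity p (p ^ (2 * s + 1) * 2 ^ s * fact s))"
    unfolding a_val_def
    by (simp only: p_valuation_of_nat[OF p(1), symmetric] A_num_fact[symmetric])
       (rule p_valuation_mult[OF p(1) A_num_nonzero, symmetric], simp only: of_nat_eq_0_iff fact_nonzero not_False_eq_True)
  ultimately show ?thesis using multiplicity_fact_le[OF p(1), of "2 * s + 1"] by linarith
qed

text \<open>This linear growth makes \<open>b_val p j\<close> exceed any given bound for large \<open>j\<close>, so that the maximum in
  \<^const>\<open>g_radius\<close> is taken over a finite set.\<close>

lemma b_val_ge: "b_val p (2 * m) \<ge> int m"
proof -
  have "multiplicity p (p ^ (2 * m)) = 2 * m"
    using p(1) by (intro multiplicity_same_power) (auto simp: prime_nat_iff)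
  moreover have "multiplicity p (2 ^ m * fact m) = multiplicity p (2 ^ m) + multiplicity p (fact m)"
    using p(1) by (intro prime_elem_multiplicity_mult_distrib) auto
  moreover have "\<not> p dvd 2 ^ m" using p by (metis prime_dvd_power primes_dvd_imp_eq two_is_prime_nat even_numeral)
  then have "multiplicity p (2 ^ m) = 0" by (rule not_dvd_imp_multiplicity_0)
  moreover have "b_val p (2 * m) + int (multiplicity p (2 ^ m * fact m)) = int (multiplicity p (p ^ (2 * m)))"
    unfolding b_val_def
    by (simp only: p_valuation_of_nat[OF p(1), symmetric] B_num_fact[symmetric])
       (rule p_valuation_mult[OF p(1) B_num_nonzero, symmetric], simp)
  ultimately show ?thesis using multiplicity_fact_le[OF p(1), of m] by linarith
qed

lemma b_val_ge_valuation_outside_radius: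
  assumes "even j" "j > g_radius p n"
  shows "b_val p j \<ge> p_valuation p (of_nat n)"
proof (rule ccontr)
  let ?S = "{j. even j \<and> b_val p j < p_valuation p (of_nat n)}"
  assume "\<not> ?thesis"
  then have "j \<in> ?S" using assms by simp
  moreover have "finite ?S"
  proof (rule finite_subset)
    show "?S \<subseteq> {..2 * nat (p_valuation p (of_nat n))}"
    proof
      fix j assume j: "j \<in> ?S"
      then obtain m where m: "j = 2 * m" by (auto elim: evenE)
      show "j \<in> {..2 * nat (p_valuation p (of_nat n))}" using j b_val_ge[of m] m by auto
    qed
  qed simp
  ultimately have "j \<le> g_radius p n" unfolding g_radius_def by (intro Max_ge)
  then show False using assms by simp
qed

lemma Z2_distance:
  assumes "int i \<in> Z2 p" "odd n" "p dvd n"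
  shows "int (g_radius p n) < \<bar>int i - int n\<bar>"
proof (rule ccontr)
  assume "\<not> ?thesis"
  then have "int i \<in> {int n - int (g_radius p n)..int n + int (g_radius p n)}" by auto
  then have "int i \<in> (\<Union>n\<in>{n. odd n \<and> p dvd n}. {int n - int (g_radius p n)..int n + int (g_radius p n)})"
    by (rule UN_I[rotated]) (simp add: assms)
  then show False using assms(1) unfolding Z2_def by (rule DiffD2[rotated])
qed

lemma Z2_odd: "int i \<in> Z2 p \<Longrightarrow> odd i"
  by (simp add: Z2_def)

lemma Z2_not_dvd:
  assumes "int i \<in> Z2 p" shows "\<not> p dvd i"
  using Z2_distance[OF assms Z2_odd[OF assms]] by auto

text \<open>The form in which membership in \<^const>\<open>Z2\<close> enters the proof: for \<open>p dvd n\<close> the distance \<open>i - n\<close> lies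
  beyond the radius \<open>g_radius p n\<close>; otherwise the right-hand side is \<open>0\<close> and the left-hand side is
  nonnegative.\<close>

lemma Z2_b_val_ge:
  assumes i: "int i \<in> Z2 p" and n: "odd n" "n < i"
  shows "b_val p (i - n) \<ge> p_valuation p (of_nat n)"
proof (cases "p dvd n")
  case True
  have "i - n > g_radius p n" using Z2_distance[OF i n(1) True] n(2) by linarith
  then show ?thesis using n Z2_odd[OF i] by (intro b_val_ge_valuation_outside_radius) auto
next
  case False
  have "odd i" using i by (rule Z2_odd)
  then obtain m where m: "i - n = 2 * m" using n by (metis evenE odd_even_add even_diff_nat less_or_eq_imp_le)
  show ?thesis using False b_val_ge[of m] m by (simp add: p_valuation_of_nat[OF p(1)] not_dvd_imp_multiplicity_0)
qed

lemma A_num_localized: "A_num p (2 * s + 1) \<in> carrier (localized_integers p)"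
  using a_val_nonneg by (intro localized_integersI p) (simp add: a_val_def)

lemma B_num_localized: "B_num p (2 * m) \<in> carrier (localized_integers p)"
  using b_val_ge[of m] by (intro localized_integersI p) (simp add: b_val_def)

lemma A_num_associated_power:
  fixes s :: nat
  defines "P \<equiv> of_nat (p ^ nat (a_val p (2 * s + 1)))"
  obtains u where "u \<in> carrier (localized_integers p)" "inverse u \<in> carrier (localized_integers p)"
    "u \<noteq> 0" "A_num p (2 * s + 1) = u * P"
proof -
  let ?A = "A_num p (2 * s + 1)"
  have P0: "P \<noteq> 0" using prime_gt_0_nat[OF p(1)] by (simp add: P_def)
  have vP: "p_valuation p P = p_valuation p ?A"
    using a_val_nonneg[of s] p(1) unfolding P_def p_valuation_of_nat[OF p(1)]
    by (subst multiplicity_same_power) (auto simp: prime_nat_iff a_val_def)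
  define u where "u = ?A / P"
  have A: "?A = u * P" using P0 by (simp add: u_def)
  have u0: "u \<noteq> 0" using A_num_nonzero P0 by (simp add: u_def)
  have vu: "p_valuation p u = 0" using p_valuation_mult[OF p(1) u0 P0, folded A] vP by linarith
  have "p_valuation p (1::rat) = 0" using p_valuation_of_nat[OF p(1), of 1] by simp
  then have "p_valuation p (inverse u) = 0"
    using p_valuation_mult[OF p(1) u0, of "inverse u"] u0 vu by simp
  then have inv: "inverse u \<in> carrier (localized_integers p)" by (intro localized_integersI[OF p(1)]) simp
  have "u \<in> carrier (localized_integers p)" using vu by (intro localized_integersI[OF p(1)]) simp
  then show thesis using inv u0 A by (rule that)
qed

lemma Z2_B_num_dvd:
  assumes i: "int i \<in> Z2 p" and n: "odd n" "n < i"
  obtains c where "c \<in> carrier (localized_integers p)" "B_num p (i - n) = of_nat n * c"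
proof -
  have "odd i" using i by (rule Z2_odd)
  then obtain m where m: "i - n = 2 * m" using n by (metis evenE odd_even_add even_diff_nat less_or_eq_imp_le)
  have n0: "of_nat n \<noteq> (0::rat)" using n by (simp add: odd_pos)
  define c where "c = B_num p (i - n) / of_nat n"
  have c: "B_num p (i - n) = of_nat n * c" using n0 by (simp add: c_def)
  have c0: "c \<noteq> 0" using B_num_nonzero m n0 by (simp add: c_def)
  have "p_valuation p c \<ge> 0"
    using Z2_b_val_ge[OF assms] p_valuation_mult[OF p(1) n0 c0] c by (simp add: b_val_def)
  then show thesis using that c localized_integersI[OF p(1)] by blast
qed

lemma inverse_localized:
  assumes "\<not> p dvd n" shows "inverse (of_nat n) \<in> carrier (localized_integers p)"
proof -
  have n: "inverse (of_nat n) = (of_int 1 / of_int (int n) :: rat)" by (simp add: inverse_eq_divide)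
  have "\<not> int p dvd int n" using assms by simp
  then have "\<exists>a b. (of_int 1 / of_int (int n) :: rat) = of_int a / of_int b \<and> \<not> int p dvd b"
    by (intro exI conjI) (rule refl)
  then show ?thesis unfolding n localized_integers_def partial_object.simps mem_Collect_eq .
qed

end

section \<open>Homomorphisms out of quotients and direct sums\<close>

lemma mod_homI:
  assumes "\<And>x. x \<in> carrier M \<Longrightarrow> f x \<in> carrier N"
    and "\<And>x y. x \<in> carrier M \<Longrightarrow> y \<in> carrier M \<Longrightarrow> f (x \<oplus>\<^bsub>M\<^esub> y) = f x \<oplus>\<^bsub>N\<^esub> f y"
    and "\<And>a x. a \<in> carrier R \<Longrightarrow> x \<in> carrier M \<Longrightarrow> f (a \<odot>\<^bsub>M\<^esub> x) = a \<odot>\<^bsub>N\<^esub> f x"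
  shows "f \<in> mod_hom R M N"
  using assms by (auto simp: mod_hom_def)

lemma mod_homD:
  assumes "f \<in> mod_hom R M N"
  shows "x \<in> carrier M \<Longrightarrow> f x \<in> carrier N"
    and "x \<in> carrier M \<Longrightarrow> y \<in> carrier M \<Longrightarrow> f (x \<oplus>\<^bsub>M\<^esub> y) = f x \<oplus>\<^bsub>N\<^esub> f y"
    and "a \<in> carrier R \<Longrightarrow> x \<in> carrier M \<Longrightarrow> f (a \<odot>\<^bsub>M\<^esub> x) = a \<odot>\<^bsub>N\<^esub> f x"
  using assms by (auto simp: mod_hom_def)

lemma mod_hom_comp:
  assumes "f \<in> mod_hom R M N" "g \<in> mod_hom R N P"
  shows "(\<lambda>x. g (f x)) \<in> mod_hom R M P"
  using assms by (auto simp: mod_hom_def Pi_iff)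

lemma mod_hom_ident: "(\<lambda>x. x) \<in> mod_hom R M M"
  by (simp add: mod_hom_def)

lemma mod_hom_restrict:
  assumes "module R M" "f \<in> mod_hom R M P"
  shows "restrict f (carrier M) \<in> mod_hom R M P"
proof -
  interpret module R M by fact
  show ?thesis by (rule mod_homI) (simp_all add: mod_homD[OF assms(2)])
qed

lemma mod_hom_zero:
  assumes "module R M" "module R N" "f \<in> mod_hom R M N"
  shows "f \<zero>\<^bsub>M\<^esub> = \<zero>\<^bsub>N\<^esub>"
proof -
  interpret M: module R M by fact
  interpret N: module R N by fact
  have "f (\<zero>\<^bsub>R\<^esub> \<odot>\<^bsub>M\<^esub> \<zero>\<^bsub>M\<^esub>) = \<zero>\<^bsub>R\<^esub> \<odot>\<^bsub>N\<^esub> f \<zero>\<^bsub>M\<^esub>"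
    using assms(3) by (rule mod_homD(3)) auto
  then show ?thesis using mod_homD(1)[OF assms(3)] by simp
qed

lemma mod_hom_finsum:
  assumes "module R M" "module R N" and f: "f \<in> mod_hom R M N"
    and "finite A" "g \<in> A \<rightarrow> carrier M"
  shows "f (finsum M g A) = finsum N (\<lambda>i. f (g i)) A"
proof -
  interpret M: module R M by fact
  interpret N: module R N by fact
  note fc = mod_homD(1)[OF f]
  show ?thesis using assms(4,5)
  proof (induction A rule: finite_induct)
    case empty
    then show ?case using mod_hom_zero[OF assms(1-3)] by simp
  next
    case (insert i A)
    then have "f (finsum M g (insert i A)) = f (g i \<oplus>\<^bsub>M\<^esub> finsum M g A)"
      by (subst M.finsum_insert) auto
    also have "\<dots> = f (g i) \<oplus>\<^bsub>N\<^esub> f (finsum M g A)"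
      using insert by (intro mod_homD(2)[OF f] M.finsum_closed) auto
    also have "\<dots> = finsum N (\<lambda>i. f (g i)) (insert i A)"
      using insert by (subst N.finsum_insert) (auto intro: fc)
    finally show ?case .
  qed
qed

text \<open>Isomorphisms are produced below from two homomorphisms obtained by universal properties, hence the
  form with an explicit inverse.\<close>

lemma module_isomorphicI:
  assumes f: "f \<in> mod_hom R M N" and g: "g \<in> mod_hom R N M"
    and "\<And>x. x \<in> carrier M \<Longrightarrow> g (f x) = x" "\<And>y. y \<in> carrier N \<Longrightarrow> f (g y) = y"
  shows "module_isomorphic R M N"
  unfolding module_isomorphic_def
  by (rule bexI[OF _ f], rule bij_betwI[where g = g])
     (use assms in \<open>auto simp: mod_hom_def\<close>)

lemma module_regular_module: "cring R \<Longrightarrow> module R (regular_module R)"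
  using N_diagram(2)[of R 1 "Plain 0"] by simp

lemma regular_module_simps [simp]:
  "carrier (regular_module R) = carrier R"
  "add (regular_module R) = add R"
  "zero (regular_module R) = zero R"
  "smult (regular_module R) = monoid.mult R"
  by (simp_all add: regular_module_def)

lemma scalar_mod_hom:
  assumes "module R P" "y \<in> carrier P"
  shows "(\<lambda>a. a \<odot>\<^bsub>P\<^esub> y) \<in> mod_hom R (regular_module R) P"
proof -
  interpret module R P by fact
  show ?thesis using assms(2) by (intro mod_homI) (auto simp: smult_l_distr smult_assoc1)
qed

lemma quotient_module_lift:
  assumes M: "module R M" and H: "submodule H R M" and P: "module R P"
    and f: "f \<in> mod_hom R M P" and f0: "\<And>x. x \<in> H \<Longrightarrow> f x = \<zero>\<^bsub>P\<^esub>"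
  obtains h where "h \<in> mod_hom R (quotient_module M H) P"
    "\<And>x. x \<in> carrier M \<Longrightarrow> h (H +>\<^bsub>M\<^esub> x) = f x"
proof -
  interpret M: module R M by (rule M)
  interpret P: module R P by (rule P)
  define h where "h C = f (SOME x. x \<in> carrier M \<and> C = H +>\<^bsub>M\<^esub> x)" for C
  have h: "h (H +>\<^bsub>M\<^esub> x) = f x" if x: "x \<in> carrier M" for x
  proof -
    let ?Q = "\<lambda>y. y \<in> carrier M \<and> H +>\<^bsub>M\<^esub> x = H +>\<^bsub>M\<^esub> y"
    have y: "?Q (SOME y. ?Q y)" by (rule someI[of ?Q x]) (use x in auto)
    define y where "y = (SOME y. ?Q y)"
    have y: "y \<in> carrier M" "H +>\<^bsub>M\<^esub> x = H +>\<^bsub>M\<^esub> y" using y by (auto simp: y_def)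
    then have "x \<ominus>\<^bsub>M\<^esub> y \<in> H" using quotient_eq_iff[OF M H x y(1)] by simp
    then have z: "f (x \<ominus>\<^bsub>M\<^esub> y) = \<zero>\<^bsub>P\<^esub>" by (rule f0)
    have "f x = f ((x \<ominus>\<^bsub>M\<^esub> y) \<oplus>\<^bsub>M\<^esub> y)"
      using x y by (simp add: a_minus_def M.M.a_assoc M.M.l_neg)
    also have "\<dots> = f y"
      using x y z mod_homD(1)[OF f] by (subst mod_homD(2)[OF f]) auto
    finally show ?thesis by (simp add: h_def y_def)
  qed
  have "h \<in> mod_hom R (quotient_module M H) P"
    by (rule mod_homI)
       (auto elim!: quotient_carrierE[OF M H] simp: quotient_simps[OF M H] h mod_homD[OF f])
  then show thesis using h by (rule that)
qed

definition cyclic_gen :: "('a, 'm) ring_scheme \<Rightarrow> nat \<Rightarrow> 'a set" where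
  "cyclic_gen R n = PIdl\<^bsub>R\<^esub> ([n] \<cdot>\<^bsub>R\<^esub> \<one>\<^bsub>R\<^esub>) +>\<^bsub>regular_module R\<^esub> \<one>\<^bsub>R\<^esub>"

context cring
begin

lemma submodule_principal_ideal:
  assumes "a \<in> carrier R"
  shows "submodule (PIdl\<^bsub>R\<^esub> a) R (regular_module R)"
proof -
  interpret M: module R "regular_module R" by (rule module_regular_module) (rule is_cring)
  interpret I: ideal "PIdl\<^bsub>R\<^esub> a" R using assms by (rule cgenideal_ideal)
  have neg: "\<ominus>\<^bsub>regular_module R\<^esub> x = \<ominus> x" if "x \<in> carrier R" for x
    using that by (intro M.M.minus_equality) (auto simp: l_neg)
  show ?thesis
    by (rule M.submoduleI) (auto simp: neg I.I_l_closed dest: I.a_subset[THEN subsetD])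
qed

lemma nat_closed: "[(n::nat)] \<cdot> \<one> \<in> carrier R"
  by simp

lemmas submodule_PIdl_nat = submodule_principal_ideal[OF nat_closed]

lemma module_cyclic_module: "module R (cyclic_module R n)"
  unfolding cyclic_module_def
  by (rule module_quotient_module[OF module_regular_module submodule_PIdl_nat]) (rule is_cring)

lemma cyclic_gen:
  shows cyclic_gen_closed: "cyclic_gen R n \<in> carrier (cyclic_module R n)"
    and cyclic_gen_torsion: "([n] \<cdot> \<one>) \<odot>\<^bsub>cyclic_module R n\<^esub> cyclic_gen R n = \<zero>\<^bsub>cyclic_module R n\<^esub>"
    and cyclic_gen_generates: "c \<in> carrier (cyclic_module R n) \<Longrightarrow>
      \<exists>a\<in>carrier R. c = a \<odot>\<^bsub>cyclic_module R n\<^esub> cyclic_gen R n"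
proof -
  note M = module_regular_module[OF is_cring]
  note H = submodule_PIdl_nat[of n]
  interpret M: module R "regular_module R" by (rule M)
  have sm: "a \<odot>\<^bsub>cyclic_module R n\<^esub> cyclic_gen R n = PIdl\<^bsub>R\<^esub> ([n] \<cdot>\<^bsub>R\<^esub> \<one>\<^bsub>R\<^esub>) +>\<^bsub>regular_module R\<^esub> a"
    if "a \<in> carrier R" for a
    using quotient_simps(4)[OF M H that, of \<one>] that by (simp add: cyclic_module_def cyclic_gen_def)
  show "cyclic_gen R n \<in> carrier (cyclic_module R n)"
    using quotient_simps(2)[OF M H, of \<one>] by (simp add: cyclic_module_def cyclic_gen_def)
  have mem: "[n] \<cdot> \<one> \<in> PIdl\<^bsub>R\<^esub> ([n] \<cdot> \<one>)" by (rule cgenideal_self) simp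
  have n0: "\<ominus>\<^bsub>regular_module R\<^esub> \<zero> = \<zero>"
    by (intro M.M.minus_equality) auto
  have "PIdl\<^bsub>R\<^esub> ([n] \<cdot>\<^bsub>R\<^esub> \<one>\<^bsub>R\<^esub>) +>\<^bsub>regular_module R\<^esub> ([n] \<cdot>\<^bsub>R\<^esub> \<one>\<^bsub>R\<^esub>)
      = PIdl\<^bsub>R\<^esub> ([n] \<cdot>\<^bsub>R\<^esub> \<one>\<^bsub>R\<^esub>) +>\<^bsub>regular_module R\<^esub> \<zero>"
    using mem by (subst quotient_eq_iff[OF M H]) (auto simp: a_minus_def n0)
  then show "([n] \<cdot> \<one>) \<odot>\<^bsub>cyclic_module R n\<^esub> cyclic_gen R n = \<zero>\<^bsub>cyclic_module R n\<^esub>"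
    unfolding sm[OF nat_closed] by (simp add: cyclic_module_def quotient_simps(1)[OF M H])
  show "\<exists>a\<in>carrier R. c = a \<odot>\<^bsub>cyclic_module R n\<^esub> cyclic_gen R n"
    if c: "c \<in> carrier (cyclic_module R n)"
  proof -
    obtain a where "a \<in> carrier R" "c = PIdl\<^bsub>R\<^esub> ([n] \<cdot>\<^bsub>R\<^esub> \<one>\<^bsub>R\<^esub>) +>\<^bsub>regular_module R\<^esub> a"
      using c unfolding cyclic_module_def by (rule quotient_carrierE[OF M H]) simp
    then show ?thesis using sm by metis
  qed
qed

lemma cyclic_module_lift:
  assumes P: "module R P" and y: "y \<in> carrier P" and ny: "([n] \<cdot> \<one>) \<odot>\<^bsub>P\<^esub> y = \<zero>\<^bsub>P\<^esub>"
  shows "\<exists>h\<in>mod_hom R (cyclic_module R n) P. h (cyclic_gen R n) = y"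
proof -
  interpret P: module R P by (rule P)
  have "x \<odot>\<^bsub>P\<^esub> y = \<zero>\<^bsub>P\<^esub>" if "x \<in> PIdl\<^bsub>R\<^esub> ([n] \<cdot> \<one>)" for x
    using that y ny by (auto simp: cgenideal_def P.smult_assoc1)
  then obtain h where "h \<in> mod_hom R (cyclic_module R n) P"
    "\<And>x. x \<in> carrier R \<Longrightarrow> h (PIdl\<^bsub>R\<^esub> ([n] \<cdot> \<one>) +>\<^bsub>regular_module R\<^esub> x) = x \<odot>\<^bsub>P\<^esub> y"
    by (rule quotient_module_lift[OF module_regular_module[OF is_cring] submodule_PIdl_nat P
        scalar_mod_hom[OF P y], of n, folded cyclic_module_def]) simp_all
  then show ?thesis using y by (intro bexI[of _ h]) (simp_all add: cyclic_gen_def)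
qed

end

lemma summand_incl_mod_hom:
  assumes "\<And>i. i \<in> I \<Longrightarrow> module R (M i)" "i \<in> I"
  shows "summand_incl I M i \<in> mod_hom R (M i) (direct_sum I M)"
proof -
  have "abelian_monoid (M j)" if "j \<in> I" for j
    using assms(1)[OF that] by (simp add: module_def abelian_group_def)
  then show ?thesis
    using module.smult_r_null[OF assms(1)] assms(2)
    by (intro mod_homI) (auto simp: summand_incl_def abelian_monoid.l_zero
        abelian_monoid.zero_closed intro!: restrict_ext)
qed

lemma direct_sum_decomposition:
  assumes R: "cring R" and M: "\<And>i. i \<in> I \<Longrightarrow> module R (M i)"
    and I: "finite I" and z: "z \<in> carrier (direct_sum I M)"
  shows "z = finsum (direct_sum I M) (\<lambda>i. summand_incl I M i (z i)) I"
proof -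
  let ?D = "direct_sum I M"
  have D: "module R ?D" using R M by (rule module_direct_sum)
  interpret D: module R ?D by (rule D)
  have zc: "z i \<in> carrier (M i)" if "i \<in> I" for i using z that by auto
  have cl: "(\<lambda>i. summand_incl I M i (z i)) \<in> I \<rightarrow> carrier ?D"
  proof (rule Pi_I)
    fix i assume i: "i \<in> I"
    have "summand_incl I M i \<in> mod_hom R (M i) (direct_sum I M)" using M i by (rule summand_incl_mod_hom)
    then show "summand_incl I M i (z i) \<in> carrier (direct_sum I M)" using zc[OF i] by (rule mod_homD(1))
  qed
  have "finsum ?D (\<lambda>i. summand_incl I M i (z i)) I j = z j" if j: "j \<in> I" for j
  proof -
    interpret Mj: module R "M j" using j by (rule M)
    have ev: "(\<lambda>w. w j) \<in> mod_hom R ?D (M j)" using j by (intro mod_homI) auto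
    have "finsum ?D (\<lambda>i. summand_incl I M i (z i)) I j = finsum (M j) (\<lambda>i. summand_incl I M i (z i) j) I"
      using mod_hom_finsum[OF D M[OF j] ev I cl] .
    also have "\<dots> = finsum (M j) (\<lambda>i. if j = i then z i else \<zero>\<^bsub>M j\<^esub>) I"
      using j zc by (intro Mj.M.finsum_cong') (auto simp: summand_incl_def)
    also have "\<dots> = finsum (M j) (\<lambda>i. if j = i then z j else \<zero>\<^bsub>M j\<^esub>) I"
      using j zc by (intro Mj.M.finsum_cong') auto
    also have "\<dots> = z j" using j zc I by (subst Mj.M.finsum_singleton) auto
    finally show ?thesis .
  qed
  moreover have "finsum ?D (\<lambda>i. summand_incl I M i (z i)) I \<in> extensional I"
    using D.M.finsum_closed[OF cl] by (simp add: PiE_def)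
  moreover have "z \<in> extensional I" using z by (simp add: PiE_def)
  ultimately show ?thesis by (intro extensionalityI[of _ I]) auto
qed

lemma direct_sum_lift:
  assumes R: "cring R" and M: "\<And>i. i \<in> I \<Longrightarrow> module R (M i)" and P: "module R P"
    and I: "finite I" and h: "\<And>i. i \<in> I \<Longrightarrow> h i \<in> mod_hom R (M i) P"
  shows "\<exists>u\<in>mod_hom R (direct_sum I M) P. \<forall>i\<in>I. \<forall>x\<in>carrier (M i). u (summand_incl I M i x) = h i x"
proof -
  interpret P: module R P by (rule P)
  note hD = mod_homD[OF h]
  let ?u = "\<lambda>z. \<Oplus>\<^bsub>P\<^esub>i\<in>I. h i (z i)"
  have "?u \<in> mod_hom R (direct_sum I M) P"
  proof (rule mod_homI)
    fix z w assume z: "z \<in> carrier (direct_sum I M)" and w: "w \<in> carrier (direct_sum I M)"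
    have "?u (z \<oplus>\<^bsub>direct_sum I M\<^esub> w) = (\<Oplus>\<^bsub>P\<^esub>i\<in>I. h i (z i) \<oplus>\<^bsub>P\<^esub> h i (w i))"
      using z w by (intro P.M.finsum_cong') (auto simp: hD PiE_iff)
    also have "\<dots> = ?u z \<oplus>\<^bsub>P\<^esub> ?u w"
      using z w by (intro P.M.finsum_addf) (auto simp: PiE_iff intro!: hD(1))
    finally show "?u (z \<oplus>\<^bsub>direct_sum I M\<^esub> w) = ?u z \<oplus>\<^bsub>P\<^esub> ?u w" .
  next
    fix a z assume a: "a \<in> carrier R" and z: "z \<in> carrier (direct_sum I M)"
    have "?u (a \<odot>\<^bsub>direct_sum I M\<^esub> z) = (\<Oplus>\<^bsub>P\<^esub>i\<in>I. a \<odot>\<^bsub>P\<^esub> h i (z i))"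
      using a z by (intro P.M.finsum_cong') (auto simp: hD PiE_iff)
    also have "\<dots> = a \<odot>\<^bsub>P\<^esub> ?u z"
      using a z I by (intro P.finsum_smult_ldistr[symmetric]) (auto simp: PiE_iff intro!: hD(1))
    finally show "?u (a \<odot>\<^bsub>direct_sum I M\<^esub> z) = a \<odot>\<^bsub>P\<^esub> ?u z" .
  qed (auto simp: PiE_iff intro!: P.M.finsum_closed hD(1))
  moreover have "?u (summand_incl I M i x) = h i x" if i: "i \<in> I" and x: "x \<in> carrier (M i)" for i x
  proof -
    have "?u (summand_incl I M i x) = (\<Oplus>\<^bsub>P\<^esub>j\<in>I. if i = j then h i x else \<zero>\<^bsub>P\<^esub>)"
      using i x by (intro P.M.finsum_cong')
        (auto simp: summand_incl_def hD(1) mod_hom_zero[OF M P h])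
    also have "\<dots> = h i x"
      using i x I by (subst P.M.finsum_singleton) (auto simp: hD(1))
    finally show ?thesis .
  qed
  ultimately show ?thesis by (intro bexI[of _ ?u] ballI)
qed

lemma direct_sum_mod_hom_eqI:
  assumes R: "cring R" and M: "\<And>i. i \<in> I \<Longrightarrow> module R (M i)" and P: "module R P"
    and I: "finite I" and f: "f \<in> mod_hom R (direct_sum I M) P" and g: "g \<in> mod_hom R (direct_sum I M) P"
    and eq: "\<And>i x. i \<in> I \<Longrightarrow> x \<in> carrier (M i) \<Longrightarrow> f (summand_incl I M i x) = g (summand_incl I M i x)"
    and z: "z \<in> carrier (direct_sum I M)"
  shows "f z = g z"
proof -
  interpret P: module R P by (rule P)
  have D: "module R (direct_sum I M)" using R M by (rule module_direct_sum)
  have zc: "z i \<in> carrier (M i)" if "i \<in> I" for i using z that by auto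
  have cl: "(\<lambda>i. summand_incl I M i (z i)) \<in> I \<rightarrow> carrier (direct_sum I M)"
  proof (rule Pi_I)
    fix i assume i: "i \<in> I"
    have "summand_incl I M i \<in> mod_hom R (M i) (direct_sum I M)" using M i by (rule summand_incl_mod_hom)
    then show "summand_incl I M i (z i) \<in> carrier (direct_sum I M)" using zc[OF i] by (rule mod_homD(1))
  qed
  have dec: "z = finsum (direct_sum I M) (\<lambda>i. summand_incl I M i (z i)) I"
    using R M I z by (rule direct_sum_decomposition)
  have "f z = f (finsum (direct_sum I M) (\<lambda>i. summand_incl I M i (z i)) I)"
    by (rule arg_cong[OF dec])
  also have "\<dots> = (\<Oplus>\<^bsub>P\<^esub>i\<in>I. f (summand_incl I M i (z i)))"
    by (rule mod_hom_finsum[OF D P f I cl])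
  also have "\<dots> = (\<Oplus>\<^bsub>P\<^esub>i\<in>I. g (summand_incl I M i (z i)))"
    by (intro P.M.finsum_cong' Pi_I eq mod_homD(1)[OF g] zc cl[THEN funcset_mem] refl)
  also have "\<dots> = g (finsum (direct_sum I M) (\<lambda>i. summand_incl I M i (z i)) I)"
    by (rule mod_hom_finsum[OF D P g I cl, symmetric])
  also have "\<dots> = g z"
    by (rule arg_cong[OF dec, symmetric])
  finally show ?thesis .
qed

lemma pair_sum_simps [simp]:
  "carrier (pair_sum M N) = carrier M \<times> carrier N"
  "zero (pair_sum M N) = (\<zero>\<^bsub>M\<^esub>, \<zero>\<^bsub>N\<^esub>)"
  "(x, y) \<oplus>\<^bsub>pair_sum M N\<^esub> (x', y') = (x \<oplus>\<^bsub>M\<^esub> x', y \<oplus>\<^bsub>N\<^esub> y')"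
  "a \<odot>\<^bsub>pair_sum M N\<^esub> (x, y) = (a \<odot>\<^bsub>M\<^esub> x, a \<odot>\<^bsub>N\<^esub> y)"
  by (simp_all add: pair_sum_def)

lemma module_pair_sum:
  assumes "module R M" "module R N"
  shows "module R (pair_sum M N)"
proof -
  interpret M: module R M by fact
  interpret N: module R N by fact
  show ?thesis
  proof (rule moduleI)
    show "abelian_group (pair_sum M N)"
    proof (rule abelian_groupI)
      fix z assume "z \<in> carrier (pair_sum M N)"
      then show "\<exists>w\<in>carrier (pair_sum M N). w \<oplus>\<^bsub>pair_sum M N\<^esub> z = \<zero>\<^bsub>pair_sum M N\<^esub>"
        by (intro bexI[of _ "(\<ominus>\<^bsub>M\<^esub> fst z, \<ominus>\<^bsub>N\<^esub> snd z)"]) (auto simp: M.M.l_neg N.M.l_neg)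
    qed (auto simp: M.M.a_ac N.M.a_ac)
  qed (auto simp: M.R.is_cring M.smult_l_distr N.smult_l_distr M.smult_r_distr N.smult_r_distr
      M.smult_assoc1 N.smult_assoc1)
qed

lemma pair_sum_lift:
  assumes P: "module R P" and f: "f \<in> mod_hom R M P" and g: "g \<in> mod_hom R N P"
  shows "(\<lambda>(x, y). f x \<oplus>\<^bsub>P\<^esub> g y) \<in> mod_hom R (pair_sum M N) P"
proof -
  interpret P: module R P by (rule P)
  show ?thesis
    by (rule mod_homI)
       (auto simp: mod_homD[OF f] mod_homD[OF g] P.smult_r_distr P.M.a_ac)
qed

section \<open>Change of generators\<close>

text \<open>The relations between the images \<open>x\<close> of \<open>1 \<in> R\<^bsub>-1\<^esub>\<close> and \<open>X s\<close> of \<open>1 \<in> R\<^bsub>2s+1\<^esub>\<close> in the colimit \<open>N\<^sub>k\<close>,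
  \<open>k = 2 r - 1\<close>. Each copy \<open>R'\<^sub>j\<close> is the source of two arrows and therefore contributes one
  equation.\<close>

definition chain_relations ::
    "('a, 'm) ring_scheme \<Rightarrow> nat \<Rightarrow> nat \<Rightarrow> ('a, 'b, 'k) module_scheme \<Rightarrow> 'b \<Rightarrow> (nat \<Rightarrow> 'b) \<Rightarrow> bool"
  where "chain_relations R p r P x X \<longleftrightarrow>
    x \<in> carrier P \<and> (\<forall>s<r. X s \<in> carrier P) \<and>
    X 0 = ([p] \<cdot>\<^bsub>R\<^esub> \<one>\<^bsub>R\<^esub>) \<odot>\<^bsub>P\<^esub> x \<and>
    (\<forall>s. Suc s < r \<longrightarrow>
      ([(2 * s + 3)] \<cdot>\<^bsub>R\<^esub> \<one>\<^bsub>R\<^esub>) \<odot>\<^bsub>P\<^esub> X (Suc s) = ([p\<^sup>2] \<cdot>\<^bsub>R\<^esub> \<one>\<^bsub>R\<^esub>) \<odot>\<^bsub>P\<^esub> X s) \<and>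
    ([p\<^sup>2] \<cdot>\<^bsub>R\<^esub> \<one>\<^bsub>R\<^esub>) \<odot>\<^bsub>P\<^esub> X (r - 1) = \<zero>\<^bsub>P\<^esub>"

definition torsion_relations ::
    "('a, 'm) ring_scheme \<Rightarrow> nat \<Rightarrow> nat \<Rightarrow> ('a, 'b, 'k) module_scheme \<Rightarrow> 'b \<Rightarrow> (nat \<Rightarrow> 'b) \<Rightarrow> bool"
  where "torsion_relations R q r P y Y \<longleftrightarrow>
    y \<in> carrier P \<and> (\<forall>s<r. Y s \<in> carrier P) \<and>
    ([q] \<cdot>\<^bsub>R\<^esub> \<one>\<^bsub>R\<^esub>) \<odot>\<^bsub>P\<^esub> y = \<zero>\<^bsub>P\<^esub> \<and>
    (\<forall>s<r. ([(2 * s + 1)] \<cdot>\<^bsub>R\<^esub> \<one>\<^bsub>R\<^esub>) \<odot>\<^bsub>P\<^esub> Y s = \<zero>\<^bsub>P\<^esub>)"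

text \<open>The change of generators. With \<open>\<alpha> s = A\<^bsub>2s+1\<^esub>\<close> and \<open>\<beta> s = B\<^bsub>2s\<^esub>\<close> it expresses the generators of
  \<open>N\<^sub>k\<close> through generators of the direct sum of cyclic modules; it is unitriangular in \<open>Y\<close> because
  \<open>\<beta> 0 = 1\<close>.\<close>

definition expansion ::
    "('a, 'b, 'k) module_scheme \<Rightarrow> (nat \<Rightarrow> 'a) \<Rightarrow> (nat \<Rightarrow> 'a) \<Rightarrow> 'b \<Rightarrow> (nat \<Rightarrow> 'b) \<Rightarrow> nat \<Rightarrow> 'b"
  where "expansion P \<alpha> \<beta> y Y s =
    \<alpha> s \<odot>\<^bsub>P\<^esub> y \<oplus>\<^bsub>P\<^esub> (\<Oplus>\<^bsub>P\<^esub>m\<in>{..s}. \<beta> (s - m) \<odot>\<^bsub>P\<^esub> Y m)"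

text \<open>What has to be known about the images of \<open>A\<^sub>j\<close> and \<open>B\<^sub>j\<close> in \<open>R\<close>. The recursions define these
  numbers. For \<open>i = 2 r + 1\<close> in \<^const>\<open>Z2\<close>, the prime \<open>p\<close> does not divide \<open>i\<close>, which gives \<open>unit\<close>, and the
  bound on \<^const>\<open>b_val\<close> gives \<open>\<beta>_dvd\<close>; \<open>q\<close> stands for \<open>p\<close> to the power \<open>a_val p i\<close>.\<close>

locale chain_coefficients = cring R for R :: "('a, 'm) ring_scheme" (structure) +
  fixes p q r :: nat and \<alpha> \<beta> :: "nat \<Rightarrow> 'a"
  assumes \<alpha>_closed: "\<alpha> s \<in> carrier R" and \<beta>_closed: "\<beta> s \<in> carrier R"
    and \<alpha>_0: "\<alpha> 0 = [p] \<cdot> \<one>" and \<beta>_0: "\<beta> 0 = \<one>"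
    and \<alpha>_Suc: "([(2 * s + 3)] \<cdot> \<one>) \<otimes> \<alpha> (Suc s) = ([p\<^sup>2] \<cdot> \<one>) \<otimes> \<alpha> s"
    and \<beta>_Suc: "([(2 * Suc s)] \<cdot> \<one>) \<otimes> \<beta> (Suc s) = ([p\<^sup>2] \<cdot> \<one>) \<otimes> \<beta> s"
    and r_pos: "r > 0"
    and unit: "[(2 * r + 1)] \<cdot> \<one> \<in> Units R"
    and \<alpha>_r: "\<exists>u\<in>Units R. \<alpha> r = u \<otimes> ([q] \<cdot> \<one>)"
    and \<beta>_dvd: "m < r \<Longrightarrow> \<exists>c\<in>carrier R. \<beta> (r - m) = c \<otimes> ([(2 * m + 1)] \<cdot> \<one>)"
begin

context
  fixes P :: "('a, 'b, 'k) module_scheme" and y :: 'b and Y :: "nat \<Rightarrow> 'b"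
  assumes P: "module R P" and y: "y \<in> carrier P" and Y: "\<And>s. s < r \<Longrightarrow> Y s \<in> carrier P"
begin

interpretation P: module R P by (rule P)

lemma expansion_closed: "s < r \<Longrightarrow> expansion P \<alpha> \<beta> y Y s \<in> carrier P"
  unfolding expansion_def
  using y Y \<alpha>_closed \<beta>_closed by (intro P.M.a_closed P.M.finsum_closed P.smult_closed Pi_I) auto

lemma expansion_0: "expansion P \<alpha> \<beta> y Y 0 = ([p] \<cdot> \<one>) \<odot>\<^bsub>P\<^esub> y \<oplus>\<^bsub>P\<^esub> Y 0"
  using y Y[of 0] r_pos by (simp add: expansion_def \<alpha>_0 \<beta>_0 atMost_0 Pi_def)

text \<open>The reason for the coefficients \<open>B\<^sub>j\<close>: as \<open>2 m + 1\<close> kills \<open>Y m\<close>, the factor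
  \<open>2 s + 3 = 2 (s + 1 - m) + (2 m + 1)\<close> acts on \<open>Y m\<close> as \<open>2 (s + 1 - m)\<close>, and the recursion of the
  \<open>B\<^sub>j\<close> turns \<open>2 (s + 1 - m) \<beta> (s + 1 - m)\<close> into \<open>p\<^sup>2 \<beta> (s - m)\<close>.\<close>

lemma scaled_sum:
  assumes s: "s < r" and tor: "\<And>m. m \<le> s \<Longrightarrow> ([(2 * m + 1)] \<cdot> \<one>) \<odot>\<^bsub>P\<^esub> Y m = \<zero>\<^bsub>P\<^esub>"
  shows "([p\<^sup>2] \<cdot> \<one>) \<odot>\<^bsub>P\<^esub> (\<Oplus>\<^bsub>P\<^esub>m\<in>{..s}. \<beta> (s - m) \<odot>\<^bsub>P\<^esub> Y m) =
    ([(2 * s + 3)] \<cdot> \<one>) \<odot>\<^bsub>P\<^esub> (\<Oplus>\<^bsub>P\<^esub>m\<in>{..s}. \<beta> (Suc s - m) \<odot>\<^bsub>P\<^esub> Y m)"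
proof -
  have Ym: "Y m \<in> carrier P" if "m \<le> s" for m using that s Y by simp
  have "([p\<^sup>2] \<cdot> \<one>) \<odot>\<^bsub>P\<^esub> (\<beta> (s - m) \<odot>\<^bsub>P\<^esub> Y m) = ([(2 * s + 3)] \<cdot> \<one>) \<odot>\<^bsub>P\<^esub> (\<beta> (Suc s - m) \<odot>\<^bsub>P\<^esub> Y m)"
    if m: "m \<le> s" for m
  proof -
    note Ym = Ym[OF m]
    have "2 * s + 3 = 2 * Suc (s - m) + (2 * m + 1)" using m by simp
    then have "[(2 * s + 3)] \<cdot> \<one> = ([(2 * Suc (s - m))] \<cdot> \<one>) \<oplus> ([(2 * m + 1)] \<cdot> \<one>)"
      by (simp only: add.nat_pow_mult[OF one_closed])
    then have "([(2 * s + 3)] \<cdot> \<one>) \<odot>\<^bsub>P\<^esub> (\<beta> (Suc s - m) \<odot>\<^bsub>P\<^esub> Y m) =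
        ([(2 * Suc (s - m))] \<cdot> \<one>) \<odot>\<^bsub>P\<^esub> (\<beta> (Suc s - m) \<odot>\<^bsub>P\<^esub> Y m) \<oplus>\<^bsub>P\<^esub>
        ([(2 * m + 1)] \<cdot> \<one>) \<odot>\<^bsub>P\<^esub> (\<beta> (Suc s - m) \<odot>\<^bsub>P\<^esub> Y m)"
      using Ym \<beta>_closed by (simp only: P.smult_l_distr[OF nat_closed nat_closed P.smult_closed])
    also have "([(2 * Suc (s - m))] \<cdot> \<one>) \<odot>\<^bsub>P\<^esub> (\<beta> (Suc s - m) \<odot>\<^bsub>P\<^esub> Y m) =
        (([(2 * Suc (s - m))] \<cdot> \<one>) \<otimes> \<beta> (Suc (s - m))) \<odot>\<^bsub>P\<^esub> Y m"
      using Ym \<beta>_closed m by (simp only: P.smult_assoc1[OF nat_closed] Suc_diff_le)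
    also have "\<dots> = ([p\<^sup>2] \<cdot> \<one>) \<odot>\<^bsub>P\<^esub> (\<beta> (s - m) \<odot>\<^bsub>P\<^esub> Y m)"
      using Ym \<beta>_closed by (simp only: \<beta>_Suc P.smult_assoc1[OF nat_closed])
    also have "([(2 * m + 1)] \<cdot> \<one>) \<odot>\<^bsub>P\<^esub> (\<beta> (Suc s - m) \<odot>\<^bsub>P\<^esub> Y m) =
        \<beta> (Suc s - m) \<odot>\<^bsub>P\<^esub> (([(2 * m + 1)] \<cdot> \<one>) \<odot>\<^bsub>P\<^esub> Y m)"
      using Ym \<beta>_closed by (simp only: P.smult_assoc1[symmetric] nat_closed m_comm)
    also have "\<dots> = \<zero>\<^bsub>P\<^esub>" using tor[OF m] \<beta>_closed by (simp only: P.smult_r_null)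
    finally show ?thesis using Ym \<beta>_closed
      by (simp only: P.M.r_zero P.smult_closed nat_closed)
  qed
  then have "(\<Oplus>\<^bsub>P\<^esub>m\<in>{..s}. ([p\<^sup>2] \<cdot> \<one>) \<odot>\<^bsub>P\<^esub> (\<beta> (s - m) \<odot>\<^bsub>P\<^esub> Y m)) =
      (\<Oplus>\<^bsub>P\<^esub>m\<in>{..s}. ([(2 * s + 3)] \<cdot> \<one>) \<odot>\<^bsub>P\<^esub> (\<beta> (Suc s - m) \<odot>\<^bsub>P\<^esub> Y m))"
    using Ym \<beta>_closed by (intro P.M.finsum_cong') (auto intro!: P.smult_closed)
  then show ?thesis
    using Ym \<beta>_closed by (subst (1 2) P.finsum_smult_ldistr) (auto intro!: P.smult_closed)
qed

text \<open>Thus, as long as the earlier \<open>Y m\<close> are torsion, the relation between \<open>X s\<close> and \<open>X (s + 1)\<close> says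
  precisely that \<open>2 s + 3\<close> kills \<open>Y (s + 1)\<close>.\<close>

lemma expansion_Suc:
  assumes s: "Suc s < r" and tor: "\<And>m. m \<le> s \<Longrightarrow> ([(2 * m + 1)] \<cdot> \<one>) \<odot>\<^bsub>P\<^esub> Y m = \<zero>\<^bsub>P\<^esub>"
  shows "([(2 * s + 3)] \<cdot> \<one>) \<odot>\<^bsub>P\<^esub> expansion P \<alpha> \<beta> y Y (Suc s) =
    ([p\<^sup>2] \<cdot> \<one>) \<odot>\<^bsub>P\<^esub> expansion P \<alpha> \<beta> y Y s \<oplus>\<^bsub>P\<^esub> ([(2 * s + 3)] \<cdot> \<one>) \<odot>\<^bsub>P\<^esub> Y (Suc s)"
proof -
  let ?S = "\<Oplus>\<^bsub>P\<^esub>m\<in>{..s}. \<beta> (s - m) \<odot>\<^bsub>P\<^esub> Y m"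
  let ?S' = "\<Oplus>\<^bsub>P\<^esub>m\<in>{..s}. \<beta> (Suc s - m) \<odot>\<^bsub>P\<^esub> Y m"
  have Ym: "Y m \<in> carrier P" if "m \<le> Suc s" for m using that s Y by simp
  have S: "?S \<in> carrier P" "?S' \<in> carrier P"
    using Ym \<beta>_closed by (auto intro!: P.M.finsum_closed P.smult_closed)
  have "(\<Oplus>\<^bsub>P\<^esub>m\<in>{..Suc s}. \<beta> (Suc s - m) \<odot>\<^bsub>P\<^esub> Y m) = Y (Suc s) \<oplus>\<^bsub>P\<^esub> ?S'"
    using Ym \<beta>_closed by (subst P.M.finsum_Suc) (auto intro!: P.smult_closed simp: \<beta>_0)
  then have e: "expansion P \<alpha> \<beta> y Y (Suc s) = \<alpha> (Suc s) \<odot>\<^bsub>P\<^esub> y \<oplus>\<^bsub>P\<^esub> (Y (Suc s) \<oplus>\<^bsub>P\<^esub> ?S')"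
    by (simp add: expansion_def)
  have "([(2 * s + 3)] \<cdot> \<one>) \<odot>\<^bsub>P\<^esub> (\<alpha> (Suc s) \<odot>\<^bsub>P\<^esub> y) = ([p\<^sup>2] \<cdot> \<one>) \<odot>\<^bsub>P\<^esub> (\<alpha> s \<odot>\<^bsub>P\<^esub> y)"
    using y by (simp only: P.smult_assoc1[symmetric] nat_closed \<alpha>_closed \<alpha>_Suc)
  moreover have "([(2 * s + 3)] \<cdot> \<one>) \<odot>\<^bsub>P\<^esub> ?S' = ([p\<^sup>2] \<cdot> \<one>) \<odot>\<^bsub>P\<^esub> ?S"
    using scaled_sum[OF Suc_lessD[OF s] tor] by simp
  ultimately show ?thesis
    unfolding e using S y Ym[of "Suc s"] \<alpha>_closed
    by (simp only: expansion_def P.smult_r_distr nat_closed P.smult_closed P.M.a_closed order_refl P.M.a_ac)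
qed

text \<open>The final relation \<open>p\<^sup>2 X (r - 1) = 0\<close> would couple all generators. By \<open>scaled_sum\<close> the coupling
  term is \<open>2 r + 1\<close> times \<open>\<Sum>\<^bsub>m<r\<^esub> \<beta> (r - m) Y m\<close>, which vanishes as \<open>2 m + 1\<close> divides \<open>\<beta> (r - m)\<close> and
  kills \<open>Y m\<close>. What remains is \<open>(2 r + 1) \<alpha> r y = 0\<close>, and \<open>(2 r + 1) \<alpha> r\<close> is a unit times \<open>q\<close>.\<close>

lemma expansion_last:
  assumes tor: "\<And>m. m < r \<Longrightarrow> ([(2 * m + 1)] \<cdot> \<one>) \<odot>\<^bsub>P\<^esub> Y m = \<zero>\<^bsub>P\<^esub>"
  shows "([p\<^sup>2] \<cdot> \<one>) \<odot>\<^bsub>P\<^esub> expansion P \<alpha> \<beta> y Y (r - 1) = \<zero>\<^bsub>P\<^esub> \<longleftrightarrow> ([q] \<cdot> \<one>) \<odot>\<^bsub>P\<^esub> y = \<zero>\<^bsub>P\<^esub>"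
proof -
  define s where "s = r - 1"
  have r: "r = Suc s" using r_pos by (simp add: s_def)
  have Ym: "Y m \<in> carrier P" if "m \<le> s" for m using that Y r by simp
  have sm: "\<beta> (Suc s - m) \<odot>\<^bsub>P\<^esub> Y m = \<zero>\<^bsub>P\<^esub>" if m: "m \<le> s" for m
  proof -
    obtain c where c: "c \<in> carrier R" "\<beta> (Suc s - m) = c \<otimes> ([(2 * m + 1)] \<cdot> \<one>)"
      using \<beta>_dvd[of m] m r by auto
    then show ?thesis using tor[of m] Ym[OF m] m r
      by (simp only: P.smult_assoc1 nat_closed P.smult_r_null less_Suc_eq_le)
  qed
  have "(\<Oplus>\<^bsub>P\<^esub>m\<in>{..s}. \<beta> (Suc s - m) \<odot>\<^bsub>P\<^esub> Y m) = (\<Oplus>\<^bsub>P\<^esub>m\<in>{..s}. \<zero>\<^bsub>P\<^esub>)"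
    using sm by (intro P.M.finsum_cong') auto
  then have S: "([p\<^sup>2] \<cdot> \<one>) \<odot>\<^bsub>P\<^esub> (\<Oplus>\<^bsub>P\<^esub>m\<in>{..s}. \<beta> (s - m) \<odot>\<^bsub>P\<^esub> Y m) = \<zero>\<^bsub>P\<^esub>"
    using scaled_sum[of s] tor r by simp
  have Sc: "(\<Oplus>\<^bsub>P\<^esub>m\<in>{..s}. \<beta> (s - m) \<odot>\<^bsub>P\<^esub> Y m) \<in> carrier P"
    using Ym \<beta>_closed by (auto intro!: P.M.finsum_closed P.smult_closed)
  obtain u where u: "u \<in> Units R" "\<alpha> r = u \<otimes> ([q] \<cdot> \<one>)" using \<alpha>_r by auto
  \<comment> \<open>The unit with \<open>(2 r + 1) \<alpha> r = w q\<close>.\<close>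
  define w where "w = ([(2 * r + 1)] \<cdot> \<one>) \<otimes> u"
  have w: "w \<in> Units R" using unit u by (simp add: w_def)
  have wc: "w \<in> carrier R" "inv w \<in> carrier R" using w by auto
  have z: "([q] \<cdot> \<one>) \<odot>\<^bsub>P\<^esub> y \<in> carrier P" using y by simp
  have "([p\<^sup>2] \<cdot> \<one>) \<odot>\<^bsub>P\<^esub> expansion P \<alpha> \<beta> y Y s = ([p\<^sup>2] \<cdot> \<one>) \<odot>\<^bsub>P\<^esub> (\<alpha> s \<odot>\<^bsub>P\<^esub> y)"
    using S Sc y \<alpha>_closed by (simp only: expansion_def P.smult_r_distr nat_closed P.smult_closed P.M.r_zero)
  also have "\<dots> = (([(2 * s + 3)] \<cdot> \<one>) \<otimes> \<alpha> (Suc s)) \<odot>\<^bsub>P\<^esub> y"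
    using y by (simp only: \<alpha>_Suc P.smult_assoc1 nat_closed \<alpha>_closed)
  also have "([(2 * s + 3)] \<cdot> \<one>) \<otimes> \<alpha> (Suc s) = w \<otimes> ([q] \<cdot> \<one>)"
    using u(2) Units_closed[OF u(1)] r by (simp add: w_def m_assoc numeral_3_eq_3 del: add.nat_pow_Suc)
  also have "\<dots> \<odot>\<^bsub>P\<^esub> y = w \<odot>\<^bsub>P\<^esub> (([q] \<cdot> \<one>) \<odot>\<^bsub>P\<^esub> y)"
    using y wc by (simp only: P.smult_assoc1 nat_closed)
  finally have e: "([p\<^sup>2] \<cdot> \<one>) \<odot>\<^bsub>P\<^esub> expansion P \<alpha> \<beta> y Y s = w \<odot>\<^bsub>P\<^esub> (([q] \<cdot> \<one>) \<odot>\<^bsub>P\<^esub> y)" .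
  have "inv w \<odot>\<^bsub>P\<^esub> (w \<odot>\<^bsub>P\<^esub> (([q] \<cdot> \<one>) \<odot>\<^bsub>P\<^esub> y)) = ([q] \<cdot> \<one>) \<odot>\<^bsub>P\<^esub> y"
    using z wc w by (simp only: P.smult_assoc1[symmetric] Units_l_inv P.smult_one)
  then show ?thesis using e wc by (metis P.smult_r_null s_def)
qed

lemma chain_relations_iff_torsion_relations:
  assumes X: "\<And>s. s < r \<Longrightarrow> X s = expansion P \<alpha> \<beta> y Y s"
  shows "chain_relations R p r P y X \<longleftrightarrow> torsion_relations R q r P y Y"
proof
  have Xc: "X s \<in> carrier P" if "s < r" for s using X that expansion_closed by simp
  have X0: "X 0 = ([p] \<cdot> \<one>) \<odot>\<^bsub>P\<^esub> y \<oplus>\<^bsub>P\<^esub> Y 0" using X[OF r_pos] expansion_0 by simp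
  {
    assume T: "torsion_relations R q r P y Y"
    then have tor: "([(2 * m + 1)] \<cdot> \<one>) \<odot>\<^bsub>P\<^esub> Y m = \<zero>\<^bsub>P\<^esub>" if "m < r" for m
      using that by (simp only: torsion_relations_def)
    have "Y 0 = \<zero>\<^bsub>P\<^esub>" using tor[OF r_pos] Y[OF r_pos] by simp
    then have "X 0 = ([p] \<cdot> \<one>) \<odot>\<^bsub>P\<^esub> y" using X0 y by simp
    moreover have "([(2 * s + 3)] \<cdot> \<one>) \<odot>\<^bsub>P\<^esub> X (Suc s) = ([p\<^sup>2] \<cdot> \<one>) \<odot>\<^bsub>P\<^esub> X s" if s: "Suc s < r" for s
    proof -
      have "2 * Suc s + 1 = 2 * s + 3" by simp
      then have "([(2 * s + 3)] \<cdot> \<one>) \<odot>\<^bsub>P\<^esub> Y (Suc s) = \<zero>\<^bsub>P\<^esub>" using tor[OF s] by (simp only:)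
      then show ?thesis using expansion_Suc[OF s] tor s Xc[of s]
        by (simp add: X del: add.nat_pow_Suc)
    qed
    moreover have "([p\<^sup>2] \<cdot> \<one>) \<odot>\<^bsub>P\<^esub> X (r - 1) = \<zero>\<^bsub>P\<^esub>"
      using expansion_last[OF tor] T X[of "r - 1"] r_pos by (simp add: torsion_relations_def)
    ultimately show "chain_relations R p r P y X" using y Xc by (simp only: chain_relations_def) blast
  next
    assume C: "chain_relations R p r P y X"
    have tor: "([(2 * m + 1)] \<cdot> \<one>) \<odot>\<^bsub>P\<^esub> Y m = \<zero>\<^bsub>P\<^esub>" if "m < r" for m
      using that
    proof (induction m rule: less_induct)
      case (less m)
      show ?case
      proof (cases m)
        case 0
        have "([p] \<cdot> \<one>) \<odot>\<^bsub>P\<^esub> y \<oplus>\<^bsub>P\<^esub> Y 0 = ([p] \<cdot> \<one>) \<odot>\<^bsub>P\<^esub> y"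
          using X0 C by (simp only: chain_relations_def)
        then have "Y 0 = \<zero>\<^bsub>P\<^esub>" using y Y[OF r_pos] by (simp add: P.M.add.l_cancel_one)
        then show ?thesis using 0 by simp
      next
        case (Suc s)
        then have s: "Suc s < r" using less by simp
        let ?c = "[(2 * s + 3)] \<cdot> \<one>"
        have "?c \<odot>\<^bsub>P\<^esub> X (Suc s) = ([p\<^sup>2] \<cdot> \<one>) \<odot>\<^bsub>P\<^esub> X s \<oplus>\<^bsub>P\<^esub> ?c \<odot>\<^bsub>P\<^esub> Y (Suc s)"
          using expansion_Suc[OF s] less Suc s by (simp add: X del: add.nat_pow_Suc)
        moreover have "?c \<odot>\<^bsub>P\<^esub> X (Suc s) = ([p\<^sup>2] \<cdot> \<one>) \<odot>\<^bsub>P\<^esub> X s"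
          using C s by (simp only: chain_relations_def)
        ultimately have "([p\<^sup>2] \<cdot> \<one>) \<odot>\<^bsub>P\<^esub> X s \<oplus>\<^bsub>P\<^esub> ?c \<odot>\<^bsub>P\<^esub> Y (Suc s) = ([p\<^sup>2] \<cdot> \<one>) \<odot>\<^bsub>P\<^esub> X s"
          by simp
        then have "?c \<odot>\<^bsub>P\<^esub> Y (Suc s) = \<zero>\<^bsub>P\<^esub>"
          using Xc[of s] Y[OF s] s by (subst (asm) P.M.add.l_cancel_one) auto
        moreover have "2 * Suc s + 1 = 2 * s + 3" by simp
        ultimately show ?thesis using Suc by (simp only:)
      qed
    qed
    moreover have "([q] \<cdot> \<one>) \<odot>\<^bsub>P\<^esub> y = \<zero>\<^bsub>P\<^esub>"
      using expansion_last[OF tor] C X[of "r - 1"] r_pos by (simp add: chain_relations_def)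
    ultimately show "torsion_relations R q r P y Y"
      using y Y by (simp only: torsion_relations_def) blast
  }
qed

lemma expansion_inject:
  assumes Z: "\<And>s. s < r \<Longrightarrow> Z s \<in> carrier P"
    and eq: "\<And>s. s < r \<Longrightarrow> expansion P \<alpha> \<beta> y Y s = expansion P \<alpha> \<beta> y Z s"
    and "s < r"
  shows "Y s = Z s"
  using \<open>s < r\<close>
proof (induction s rule: less_induct)
  case (less s)
  let ?S = "\<lambda>Y. \<Oplus>\<^bsub>P\<^esub>m\<in>{..<s}. \<beta> (s - m) \<odot>\<^bsub>P\<^esub> Y m"
  have split: "expansion P \<alpha> \<beta> y W s = \<alpha> s \<odot>\<^bsub>P\<^esub> y \<oplus>\<^bsub>P\<^esub> (W s \<oplus>\<^bsub>P\<^esub> ?S W)"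
    if W: "\<And>m. m \<le> s \<Longrightarrow> W m \<in> carrier P" for W
  proof -
    have "{..s} = insert s {..<s}" by auto
    then show ?thesis using W \<beta>_closed
      by (simp add: expansion_def \<beta>_0)
  qed
  have "?S Y = ?S Z"
    using less Y Z \<beta>_closed by (intro P.M.finsum_cong') (auto intro!: P.smult_closed)
  moreover have "?S Y \<in> carrier P"
    using less.prems Y \<beta>_closed by (auto intro!: P.M.finsum_closed P.smult_closed)
  ultimately show ?case
    using eq[OF less.prems] split[of Y] split[of Z] Y Z less.prems y \<alpha>_closed
    by (simp add: P.M.add.Units_l_cancel P.M.add.right_cancel)
qed

end

text \<open>
  Unitriangularity: the \<open>Y s\<close> are recovered from the \<open>X s\<close> one after the other.
\<close>

lemma expansion_surj:
  assumes P: "module R P" and y: "y \<in> carrier P" and X: "\<And>s. s < r \<Longrightarrow> X s \<in> carrier P"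
  shows "\<exists>Y. (\<forall>s<r. Y s \<in> carrier P) \<and> (\<forall>s<r. X s = expansion P \<alpha> \<beta> y Y s)"
proof -
  interpret P: module R P by (rule P)
  have "\<exists>Y. (\<forall>s<n. Y s \<in> carrier P) \<and> (\<forall>s<n. X s = expansion P \<alpha> \<beta> y Y s)" if "n \<le> r" for n
    using that
  proof (induction n)
    case (Suc n)
    then obtain Y where Y: "\<And>s. s < n \<Longrightarrow> Y s \<in> carrier P" "\<And>s. s < n \<Longrightarrow> X s = expansion P \<alpha> \<beta> y Y s"
      by auto
    have Xn: "X n \<in> carrier P" using X Suc by simp
    define S where "S = (\<Oplus>\<^bsub>P\<^esub>m\<in>{..<n}. \<beta> (n - m) \<odot>\<^bsub>P\<^esub> Y m)"
    have S: "S \<in> carrier P" unfolding S_def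
      using Y \<beta>_closed by (auto intro!: P.M.finsum_closed P.smult_closed)
    have ay: "\<alpha> n \<odot>\<^bsub>P\<^esub> y \<in> carrier P" using y \<alpha>_closed by simp
    define v where "v = X n \<ominus>\<^bsub>P\<^esub> (\<alpha> n \<odot>\<^bsub>P\<^esub> y \<oplus>\<^bsub>P\<^esub> S)"
    have v: "v \<in> carrier P" using Xn S ay by (simp add: v_def)
    let ?Y = "Y(n := v)"
    have low: "expansion P \<alpha> \<beta> y ?Y s = expansion P \<alpha> \<beta> y Y s" if "s < n" for s
      unfolding expansion_def using that Y \<beta>_closed
      by (intro arg_cong2[where f = "add P"] refl P.M.finsum_cong') (auto intro!: P.smult_closed)
    have "{..n} = insert n {..<n}" by auto
    then have "expansion P \<alpha> \<beta> y ?Y n = \<alpha> n \<odot>\<^bsub>P\<^esub> y \<oplus>\<^bsub>P\<^esub> (v \<oplus>\<^bsub>P\<^esub> (\<Oplus>\<^bsub>P\<^esub>m\<in>{..<n}. \<beta> (n - m) \<odot>\<^bsub>P\<^esub> ?Y m))"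
      using Y v \<beta>_closed
      by (simp add: expansion_def \<beta>_0)
    also have "(\<Oplus>\<^bsub>P\<^esub>m\<in>{..<n}. \<beta> (n - m) \<odot>\<^bsub>P\<^esub> ?Y m) = S" unfolding S_def
      using Y \<beta>_closed by (intro P.M.finsum_cong') (auto intro!: P.smult_closed)
    also have "\<alpha> n \<odot>\<^bsub>P\<^esub> y \<oplus>\<^bsub>P\<^esub> (v \<oplus>\<^bsub>P\<^esub> S) = v \<oplus>\<^bsub>P\<^esub> (\<alpha> n \<odot>\<^bsub>P\<^esub> y \<oplus>\<^bsub>P\<^esub> S)"
      using v S ay by (simp add: P.M.a_lcomm)
    also have "\<dots> = X n"
      using Xn S ay by (simp add: v_def a_minus_def P.M.a_assoc P.M.l_neg)
    finally have top: "expansion P \<alpha> \<beta> y ?Y n = X n" .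
    have "X s = expansion P \<alpha> \<beta> y ?Y s" if "s < Suc n" for s
    proof (cases "s = n")
      case True
      then show ?thesis by (simp only: top)
    next
      case False
      then show ?thesis using low Y(2) that by (simp add: less_Suc_eq)
    qed
    then have "\<forall>s<Suc n. X s = expansion P \<alpha> \<beta> y ?Y s" by blast
    moreover have "\<forall>s<Suc n. ?Y s \<in> carrier P" using Y(1) v by simp
    ultimately show ?case by (intro exI[of _ ?Y] conjI)
  qed simp
  then show ?thesis by blast
qed

lemma mod_hom_expansion:
  assumes P: "module R P" and Q: "module R Q" and f: "f \<in> mod_hom R P Q"
    and y: "y \<in> carrier P" and Y: "\<And>s. s < r \<Longrightarrow> Y s \<in> carrier P" and s: "s < r"
  shows "f (expansion P \<alpha> \<beta> y Y s) = expansion Q \<alpha> \<beta> (f y) (\<lambda>m. f (Y m)) s"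
proof -
  interpret P: module R P by (rule P)
  interpret Q: module R Q by (rule Q)
  have cl: "(\<lambda>m. \<beta> (s - m) \<odot>\<^bsub>P\<^esub> Y m) \<in> {..s} \<rightarrow> carrier P"
    using Y s \<beta>_closed by (auto intro!: P.smult_closed)
  have "f (expansion P \<alpha> \<beta> y Y s) =
      f (\<alpha> s \<odot>\<^bsub>P\<^esub> y) \<oplus>\<^bsub>Q\<^esub> f (\<Oplus>\<^bsub>P\<^esub>m\<in>{..s}. \<beta> (s - m) \<odot>\<^bsub>P\<^esub> Y m)"
    unfolding expansion_def using y \<alpha>_closed cl by (intro mod_homD(2)[OF f]) auto
  also have "f (\<alpha> s \<odot>\<^bsub>P\<^esub> y) = \<alpha> s \<odot>\<^bsub>Q\<^esub> f y" using \<alpha>_closed y by (rule mod_homD(3)[OF f])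
  also have "f (\<Oplus>\<^bsub>P\<^esub>m\<in>{..s}. \<beta> (s - m) \<odot>\<^bsub>P\<^esub> Y m) = (\<Oplus>\<^bsub>Q\<^esub>m\<in>{..s}. f (\<beta> (s - m) \<odot>\<^bsub>P\<^esub> Y m))"
    using P Q f finite_atMost cl by (rule mod_hom_finsum)
  also have "\<dots> = (\<Oplus>\<^bsub>Q\<^esub>m\<in>{..s}. \<beta> (s - m) \<odot>\<^bsub>Q\<^esub> f (Y m))"
    using Y s \<beta>_closed by (intro Q.M.finsum_cong') (auto simp: mod_homD[OF f])
  finally show ?thesis by (simp add: expansion_def)
qed

end

section \<open>Presentations of the two modules\<close>

abbreviation torsion_sum ::
    "('a, 'm) ring_scheme \<Rightarrow> nat \<Rightarrow> nat \<Rightarrow> ('a, 'a set \<times> (nat \<Rightarrow> 'a set)) module" where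
  "torsion_sum R q r \<equiv>
    pair_sum (cyclic_module R q) (direct_sum {n. odd n \<and> n \<le> 2 * r - 1} (cyclic_module R))"

text \<open>The standard generators of the direct sum, the class of \<open>1\<close> in \<open>R/q\<close> and those in the summands
  \<open>R/(2 s + 1)\<close>. Together with \<^const>\<open>torsion_relations\<close> they present it, which is the content of the
  three lemmas \<open>torsion_relations_torsion_sum\<close>, \<open>torsion_sum_lift\<close> and \<open>torsion_sum_mod_hom_eqI\<close>.\<close>

definition torsion_sum_fst_gen ::
    "('a, 'm) ring_scheme \<Rightarrow> nat \<Rightarrow> nat \<Rightarrow> 'a set \<times> (nat \<Rightarrow> 'a set)" where
  "torsion_sum_fst_gen R q r =
    (cyclic_gen R q, \<zero>\<^bsub>direct_sum {n. odd n \<and> n \<le> 2 * r - 1} (cyclic_module R)\<^esub>)"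

definition torsion_sum_snd_gen ::
    "('a, 'm) ring_scheme \<Rightarrow> nat \<Rightarrow> nat \<Rightarrow> nat \<Rightarrow> 'a set \<times> (nat \<Rightarrow> 'a set)" where
  "torsion_sum_snd_gen R q r s = (\<zero>\<^bsub>cyclic_module R q\<^esub>,
    summand_incl {n. odd n \<and> n \<le> 2 * r - 1} (cyclic_module R) (2 * s + 1) (cyclic_gen R (2 * s + 1)))"

context cring
begin

context
  fixes q r :: nat
  assumes r: "r > 0"
begin

private abbreviation "J \<equiv> {n. odd n \<and> n \<le> 2 * r - 1}"
private abbreviation "D \<equiv> direct_sum J (cyclic_module R)"
private abbreviation "T \<equiv> torsion_sum R q r"

lemma finite_odd_upto: "finite J"
  by (rule finite_subset[of _ "{..2 * r - 1}"]) auto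

lemma odd_upto_iff: "n \<in> J \<longleftrightarrow> (\<exists>s<r. n = 2 * s + 1)"
  using r by (auto elim!: oddE intro: exI[of _ "n div 2"])

lemma module_odd_cyclic_sum: "module R D"
  by (rule module_direct_sum[OF is_cring module_cyclic_module])

lemma module_torsion_sum: "module R T"
  by (rule module_pair_sum[OF module_cyclic_module module_odd_cyclic_sum])

lemma torsion_sum_incl_fst: "(\<lambda>c. (c, \<zero>\<^bsub>D\<^esub>)) \<in> mod_hom R (cyclic_module R q) T"
proof -
  interpret D: module R D by (rule module_odd_cyclic_sum)
  show ?thesis
    by (rule mod_homI) (simp_all only: pair_sum_simps D.M.zero_closed D.M.l_zero D.smult_r_null SigmaI)
qed

lemma torsion_sum_incl_snd: "(\<lambda>d. (\<zero>\<^bsub>cyclic_module R q\<^esub>, d)) \<in> mod_hom R D T"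
proof -
  interpret C: module R "cyclic_module R q" by (rule module_cyclic_module)
  show ?thesis
    by (rule mod_homI) (simp_all only: pair_sum_simps C.M.zero_closed C.M.l_zero C.smult_r_null SigmaI)
qed

lemma torsion_sum_incl_summand:
  assumes "n \<in> J"
  shows "(\<lambda>c. (\<zero>\<^bsub>cyclic_module R q\<^esub>, summand_incl J (cyclic_module R) n c)) \<in> mod_hom R (cyclic_module R n) T"
  by (rule mod_hom_comp[OF summand_incl_mod_hom[OF module_cyclic_module assms] torsion_sum_incl_snd])

lemma torsion_relations_torsion_sum:
  "torsion_relations R q r T (torsion_sum_fst_gen R q r) (torsion_sum_snd_gen R q r)"
proof -
  have "torsion_sum_fst_gen R q r \<in> carrier T"
    unfolding torsion_sum_fst_gen_def by (rule mod_homD(1)[OF torsion_sum_incl_fst cyclic_gen_closed])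
  moreover have "([q] \<cdot> \<one>) \<odot>\<^bsub>T\<^esub> torsion_sum_fst_gen R q r = \<zero>\<^bsub>T\<^esub>"
    unfolding torsion_sum_fst_gen_def mod_homD(3)[OF torsion_sum_incl_fst nat_closed cyclic_gen_closed, symmetric]
      cyclic_gen_torsion
    by (rule mod_hom_zero[OF module_cyclic_module module_torsion_sum torsion_sum_incl_fst])
  moreover have "torsion_sum_snd_gen R q r s \<in> carrier T"
    and "([(2 * s + 1)] \<cdot> \<one>) \<odot>\<^bsub>T\<^esub> torsion_sum_snd_gen R q r s = \<zero>\<^bsub>T\<^esub>" if "s < r" for s
  proof -
    have s: "2 * s + 1 \<in> J" unfolding odd_upto_iff using that by blast
    show "torsion_sum_snd_gen R q r s \<in> carrier T"
      unfolding torsion_sum_snd_gen_def by (rule mod_homD(1)[OF torsion_sum_incl_summand[OF s] cyclic_gen_closed])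
    show "([(2 * s + 1)] \<cdot> \<one>) \<odot>\<^bsub>T\<^esub> torsion_sum_snd_gen R q r s = \<zero>\<^bsub>T\<^esub>"
      unfolding torsion_sum_snd_gen_def
        mod_homD(3)[OF torsion_sum_incl_summand[OF s] nat_closed cyclic_gen_closed, symmetric] cyclic_gen_torsion
      by (rule mod_hom_zero[OF module_cyclic_module module_torsion_sum torsion_sum_incl_summand[OF s]])
  qed
  ultimately show ?thesis unfolding torsion_relations_def by blast
qed

lemma torsion_sum_lift:
  assumes P: "module R P" and rel: "torsion_relations R q r P y Y"
  shows "\<exists>h\<in>mod_hom R T P. h (torsion_sum_fst_gen R q r) = y \<and> (\<forall>s<r. h (torsion_sum_snd_gen R q r s) = Y s)"
proof -
  interpret P: module R P by (rule P)
  have y: "y \<in> carrier P" "([q] \<cdot> \<one>) \<odot>\<^bsub>P\<^esub> y = \<zero>\<^bsub>P\<^esub>"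
    using rel by (simp_all only: torsion_relations_def)
  have Y: "Y s \<in> carrier P" "([(2 * s + 1)] \<cdot> \<one>) \<odot>\<^bsub>P\<^esub> Y s = \<zero>\<^bsub>P\<^esub>" if "s < r" for s
    using rel that by (simp_all only: torsion_relations_def)
  obtain h0 where h0: "h0 \<in> mod_hom R (cyclic_module R q) P" "h0 (cyclic_gen R q) = y"
    using cyclic_module_lift[OF P y] by blast
  have ex: "\<exists>h. h \<in> mod_hom R (cyclic_module R n) P \<and> h (cyclic_gen R n) = Y (n div 2)" if n: "n \<in> J" for n
  proof -
    obtain s where s: "s < r" "n = 2 * s + 1" using n unfolding odd_upto_iff by blast
    have d: "(2 * s + 1) div 2 = s" by simp
    show ?thesis unfolding s(2) d by (rule cyclic_module_lift[OF P Y[OF s(1)], unfolded Bex_def])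
  qed
  define hn where "hn n = (SOME h. h \<in> mod_hom R (cyclic_module R n) P \<and> h (cyclic_gen R n) = Y (n div 2))" for n
  have hn: "hn n \<in> mod_hom R (cyclic_module R n) P" "hn n (cyclic_gen R n) = Y (n div 2)" if "n \<in> J" for n
    using someI_ex[OF ex[OF that]] unfolding hn_def by simp_all
  have "\<exists>h1\<in>mod_hom R D P. \<forall>n\<in>J. \<forall>x\<in>carrier (cyclic_module R n).
      h1 (summand_incl J (cyclic_module R) n x) = hn n x"
    using is_cring module_cyclic_module P finite_odd_upto hn(1) by (rule direct_sum_lift)
  then obtain h1 where h1: "h1 \<in> mod_hom R D P"
      "\<And>n x. n \<in> J \<Longrightarrow> x \<in> carrier (cyclic_module R n) \<Longrightarrow> h1 (summand_incl J (cyclic_module R) n x) = hn n x"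
    by blast
  let ?h = "\<lambda>(c, d). h0 c \<oplus>\<^bsub>P\<^esub> h1 d"
  have "?h \<in> mod_hom R T P" by (rule pair_sum_lift[OF P h0(1) h1(1)])
  moreover have "?h (torsion_sum_fst_gen R q r) = y"
    using h0(2) mod_hom_zero[OF module_odd_cyclic_sum P h1(1)] y(1)
    by (simp add: torsion_sum_fst_gen_def del: direct_sum_simps)
  moreover have "?h (torsion_sum_snd_gen R q r s) = Y s" if s: "s < r" for s
  proof -
    have "2 * s + 1 \<in> J" unfolding odd_upto_iff using s by blast
    then have "h1 (summand_incl J (cyclic_module R) (2 * s + 1) (cyclic_gen R (2 * s + 1))) = Y s"
      using h1(2)[OF _ cyclic_gen_closed] hn(2)[of "2 * s + 1"] by simp
    then show ?thesis using mod_hom_zero[OF module_cyclic_module P h0(1)] Y(1)[OF s]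
      by (simp only: torsion_sum_snd_gen_def prod.case P.M.l_zero)
  qed
  ultimately show ?thesis by (intro bexI[of _ ?h] conjI allI impI)
qed

lemma torsion_sum_mod_hom_eqI:
  assumes P: "module R P" and f: "f \<in> mod_hom R T P" and g: "g \<in> mod_hom R T P"
    and fst: "f (torsion_sum_fst_gen R q r) = g (torsion_sum_fst_gen R q r)"
    and snd: "\<And>s. s < r \<Longrightarrow> f (torsion_sum_snd_gen R q r s) = g (torsion_sum_snd_gen R q r s)"
    and z: "z \<in> carrier T"
  shows "f z = g z"
proof -
  interpret D: module R D by (rule module_odd_cyclic_sum)
  interpret C: module R "cyclic_module R q" by (rule module_cyclic_module)
  note cgen = mod_homD(3)[OF _ _ cyclic_gen_closed]
  obtain c d where z: "z = (c, d)" "c \<in> carrier (cyclic_module R q)" "d \<in> carrier D"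
    using z by (simp only: pair_sum_simps) blast
  have c: "f (c, \<zero>\<^bsub>D\<^esub>) = g (c, \<zero>\<^bsub>D\<^esub>)"
  proof -
    obtain a where a: "a \<in> carrier R" "c = a \<odot>\<^bsub>cyclic_module R q\<^esub> cyclic_gen R q"
      using cyclic_gen_generates[OF z(2)] by blast
    show ?thesis unfolding a(2)
      using cgen[OF mod_hom_comp[OF torsion_sum_incl_fst f] a(1)] cgen[OF mod_hom_comp[OF torsion_sum_incl_fst g] a(1)] fst
      by (simp only: torsion_sum_fst_gen_def)
  qed
  have "f (\<zero>\<^bsub>cyclic_module R q\<^esub>, summand_incl J (cyclic_module R) n x) =
        g (\<zero>\<^bsub>cyclic_module R q\<^esub>, summand_incl J (cyclic_module R) n x)"
    if n: "n \<in> J" and x: "x \<in> carrier (cyclic_module R n)" for n x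
  proof -
    obtain s where s: "s < r" "n = 2 * s + 1" using n unfolding odd_upto_iff by blast
    obtain a where a: "a \<in> carrier R" "x = a \<odot>\<^bsub>cyclic_module R n\<^esub> cyclic_gen R n"
      using cyclic_gen_generates[OF x] by blast
    show ?thesis unfolding a(2)
      using cgen[OF mod_hom_comp[OF torsion_sum_incl_summand[OF n] f] a(1)]
        cgen[OF mod_hom_comp[OF torsion_sum_incl_summand[OF n] g] a(1)] snd[OF s(1)] s(2)
      by (simp only: torsion_sum_snd_gen_def)
  qed
  then have d: "f (\<zero>\<^bsub>cyclic_module R q\<^esub>, d) = g (\<zero>\<^bsub>cyclic_module R q\<^esub>, d)"
    by (rule direct_sum_mod_hom_eqI[OF is_cring module_cyclic_module P finite_odd_upto
        mod_hom_comp[OF torsion_sum_incl_snd f] mod_hom_comp[OF torsion_sum_incl_snd g] _ z(3)])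
  have zz: "z = (c, \<zero>\<^bsub>D\<^esub>) \<oplus>\<^bsub>T\<^esub> (\<zero>\<^bsub>cyclic_module R q\<^esub>, d)"
    using z by (simp only: pair_sum_simps D.M.l_zero C.M.r_zero)
  have cl: "(c, \<zero>\<^bsub>D\<^esub>) \<in> carrier T" "(\<zero>\<^bsub>cyclic_module R q\<^esub>, d) \<in> carrier T"
    using z by (simp_all only: pair_sum_simps SigmaI D.M.zero_closed C.M.zero_closed)
  show ?thesis
    unfolding zz mod_homD(2)[OF f cl] mod_homD(2)[OF g cl] c d ..
qed

end

end

text \<open>In the same way \<open>N\<^sub>k\<close> is presented by the images of \<open>1 \<in> R\<^sub>j\<close> and \<^const>\<open>chain_relations\<close>; this is
  read off from the universal property of the colimit.\<close>

definition N_incl ::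
    "('a, 'm) ring_scheme \<Rightarrow> nat \<Rightarrow> nat \<Rightarrow> node \<Rightarrow> 'a \<Rightarrow> (node \<Rightarrow> 'a) set" where
  "N_incl R p k = colimit_incl R (N_nodes k) (N_object R) (N_arrows R p k)"

definition N_gen :: "('a, 'm) ring_scheme \<Rightarrow> nat \<Rightarrow> nat \<Rightarrow> int \<Rightarrow> (node \<Rightarrow> 'a) set" where
  "N_gen R p k j = N_incl R p k (Plain j) \<one>\<^bsub>R\<^esub>"

context cring
begin

context
  fixes p r :: nat
  assumes r: "r > 0"
begin

private abbreviation "k \<equiv> 2 * r - 1"
private abbreviation "N \<equiv> N_module R p k"

lemma odd_length: "odd k" using r by simp

lemma int_length: "int k = 2 * int r - 1" using r by simp

lemma module_N: "module R N"
  unfolding N_module_def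
  by (rule colimit_universal_property(1)[OF is_cring N_diagram(1)[OF is_cring odd_length]
        N_diagram(2)[OF is_cring odd_length] N_diagram(3)[OF is_cring odd_length]])

lemma N_incl_mod_hom:
  assumes "v \<in> N_nodes k"
  shows "N_incl R p k v \<in> mod_hom R (N_object R v) N"
  unfolding N_module_def N_incl_def
  by (rule colimit_universal_property(2)[OF is_cring N_diagram(1)[OF is_cring odd_length]
        N_diagram(2)[OF is_cring odd_length] N_diagram(3)[OF is_cring odd_length] assms])

lemma N_incl_arrow:
  assumes "(s, t, f) \<in> N_arrows R p k" "x \<in> carrier (N_object R s)"
  shows "N_incl R p k t (f x) = N_incl R p k s x"
  unfolding N_incl_def
  by (rule colimit_universal_property(3)[OF is_cring N_diagram(1)[OF is_cring odd_length]
        N_diagram(2)[OF is_cring odd_length] N_diagram(3)[OF is_cring odd_length] assms])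

lemma N_universal_property:
  assumes "module R P" "\<And>v. v \<in> N_nodes k \<Longrightarrow> h v \<in> mod_hom R (N_object R v) P"
    and "\<And>s t f x. (s, t, f) \<in> N_arrows R p k \<Longrightarrow> x \<in> carrier (N_object R s) \<Longrightarrow> h t (f x) = h s x"
  shows "\<exists>!u. u \<in> mod_hom R N P \<inter> extensional (carrier N) \<and>
    (\<forall>v\<in>N_nodes k. \<forall>a\<in>carrier (N_object R v). u (N_incl R p k v a) = h v a)"
  unfolding N_module_def N_incl_def
  by (rule colimit_universal_property(4)[where E = "N_arrows R p k" and h = h, OF is_cring
        N_diagram(1)[OF is_cring odd_length] N_diagram(2)[OF is_cring odd_length] N_diagram(3)[OF is_cring odd_length]])
     (assumption | fact assms)+

lemma N_arrowE:
  assumes "(s, t, f) \<in> N_arrows R p k"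
  obtains j where "odd j" "1 \<le> j" "j \<le> int k" "s = Primed j" "t = Plain j" "f = (\<lambda>x. [j] \<cdot> x)"
  | "s = Primed 1" "t = Plain (-1)" "f = (\<lambda>x. [p] \<cdot> x)"
  | j where "odd j" "3 \<le> j" "j \<le> int k + 2" "s = Primed j" "t = Plain (j - 2)" "f = (\<lambda>x. [p\<^sup>2] \<cdot> x)"
  | "s = Primed (int k + 2)" "t = Null" "f = (\<lambda>x. \<zero>)"
  using assms unfolding N_arrows_def by blast

lemma int_multiple: "x \<in> carrier R \<Longrightarrow> [(j::int)] \<cdot> x = x \<otimes> ([j] \<cdot> \<one>)"
  using add_pow_rdistr_int[of x \<one> j] by simp

lemma nat_multiple: "x \<in> carrier R \<Longrightarrow> [(n::nat)] \<cdot> x = x \<otimes> ([n] \<cdot> \<one>)"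
  using add_pow_rdistr[of x \<one> n] by simp

lemma N_lift:
  assumes P: "module R P" and rel: "chain_relations R p r P x X"
  shows "\<exists>h\<in>mod_hom R N P. h (N_gen R p k (-1)) = x \<and> (\<forall>s<r. h (N_gen R p k (2 * int s + 1)) = X s)"
proof -
  interpret P: module R P by (rule P)
  have x: "x \<in> carrier P" and X: "\<And>s. s < r \<Longrightarrow> X s \<in> carrier P"
    and rel0: "X 0 = ([p] \<cdot> \<one>) \<odot>\<^bsub>P\<^esub> x"
    and relS: "\<And>s. Suc s < r \<Longrightarrow> ([(2 * s + 3)] \<cdot> \<one>) \<odot>\<^bsub>P\<^esub> X (Suc s) = ([p\<^sup>2] \<cdot> \<one>) \<odot>\<^bsub>P\<^esub> X s"
    and rel_last: "([p\<^sup>2] \<cdot> \<one>) \<odot>\<^bsub>P\<^esub> X (r - 1) = \<zero>\<^bsub>P\<^esub>"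
    using rel by (simp_all only: chain_relations_def)
  \<comment> \<open>The prescribed image of \<open>1 \<in> R\<^sub>j\<close>; the primed copies then have to be mapped along their arrows.\<close>
  define G where "G j = (if j = -1 then x else X (nat (j div 2)))" for j :: int
  have G: "G j \<in> carrier P" if "odd j" "-1 \<le> j" "j \<le> int k" for j
    using that x r by (auto simp: G_def int_length intro!: X elim!: oddE)
  define h where "h v = (case v of Null \<Rightarrow> (\<lambda>a. \<zero>\<^bsub>P\<^esub>) | Plain j \<Rightarrow> (\<lambda>a. a \<odot>\<^bsub>P\<^esub> G j)
    | Primed j \<Rightarrow> (\<lambda>a. if j = int k + 2 then \<zero>\<^bsub>P\<^esub> else a \<odot>\<^bsub>P\<^esub> (([j] \<cdot> \<one>) \<odot>\<^bsub>P\<^esub> G j)))" for v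
  have h_hom: "h v \<in> mod_hom R (N_object R v) P" if v: "v \<in> N_nodes k" for v
  proof (cases v)
    case Null
    then show ?thesis by (auto simp: h_def mod_hom_def zero_module_def)
  next
    case (Plain j)
    then have "G j \<in> carrier P" using v by (intro G) (auto simp: N_nodes_def)
    then show ?thesis using scalar_mod_hom[OF P] Plain by (simp add: h_def)
  next
    case (Primed j)
    show ?thesis
    proof (cases "j = int k + 2")
      case True
      then show ?thesis using Primed by (auto simp: h_def mod_hom_def)
    next
      case False
      then have "odd j" "1 \<le> j" "j \<le> int k"
        using v Primed r unfolding int_length by (auto simp: N_nodes_def int_length elim!: oddE)
      then have "([j] \<cdot> \<one>) \<odot>\<^bsub>P\<^esub> G j \<in> carrier P" by (intro P.smult_closed G) auto
      then show ?thesis using scalar_mod_hom[OF P] Primed False by (simp add: h_def)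
    qed
  qed
  have h_comm: "h t (f a) = h s a" if "(s, t, f) \<in> N_arrows R p k" "a \<in> carrier (N_object R s)" for s t f a
    using that(1)
  proof (cases rule: N_arrowE)
    case (1 j)
    have a: "a \<in> carrier R" using that(2) 1 by simp
    have Gj: "G j \<in> carrier P" using 1 by (intro G) auto
    have ne: "j \<noteq> int k + 2" using 1(3) by linarith
    have "h t (f a) = (a \<otimes> ([j] \<cdot> \<one>)) \<odot>\<^bsub>P\<^esub> G j" by (simp add: h_def 1 int_multiple[OF a])
    also have "\<dots> = a \<odot>\<^bsub>P\<^esub> (([j] \<cdot> \<one>) \<odot>\<^bsub>P\<^esub> G j)" using a Gj by (simp add: P.smult_assoc1)
    also have "\<dots> = h s a" using ne by (simp only: h_def 1(4) node.case if_False)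
    finally show ?thesis .
  next
    case 2
    have a: "a \<in> carrier R" using that(2) 2 by simp
    have "h t (f a) = a \<odot>\<^bsub>P\<^esub> (([p] \<cdot> \<one>) \<odot>\<^bsub>P\<^esub> x)"
      using a 2 x by (simp add: h_def G_def nat_multiple[OF a] P.smult_assoc1)
    also have "\<dots> = h s a" using 2 a r X[OF r] rel0[symmetric] by (simp add: h_def G_def)
    finally show ?thesis .
  next
    case (3 j)
    have a: "a \<in> carrier R" using that(2) 3 by simp
    obtain b where b: "j = 2 * b + 1" using 3(1) by (rule oddE)
    define m where "m = nat (b - 1)"
    have j: "j = 2 * int m + 3" using 3(2) b by (simp add: m_def)
    have m: "m < r" using 3(3) j int_length by linarith
    have Gm: "G (j - 2) = X m" by (simp add: G_def j)
    have "h t (f a) = a \<odot>\<^bsub>P\<^esub> (([p\<^sup>2] \<cdot> \<one>) \<odot>\<^bsub>P\<^esub> X m)"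
      using a 3 X[OF m] by (simp add: h_def Gm nat_multiple[OF a] P.smult_assoc1)
    also have "\<dots> = h s a"
    proof (cases "j = int k + 2")
      case True
      then have "m = r - 1" using j int_length by linarith
      then show ?thesis using rel_last a 3(4) True by (simp add: h_def)
    next
      case False
      then have m': "Suc m < r" using j m int_length by linarith
      have "[j] \<cdot> \<one> = [(2 * m + 3)] \<cdot> \<one>"
        unfolding j using add_pow_int_ge[of "2 * int m + 3" R \<one>] by (simp add: nat_add_distrib nat_mult_distrib)
      moreover have "nat (int m + 1) = Suc m" by linarith
      then have "G j = X (Suc m)" by (simp add: G_def j)
      ultimately show ?thesis using relS[OF m'] False 3(4) by (simp add: h_def)
    qed
    finally show ?thesis .
  next
    case 4
    then show ?thesis by (simp add: h_def)
  qed
  have univ: "\<exists>!u. u \<in> mod_hom R N P \<inter> extensional (carrier N) \<and>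
      (\<forall>v\<in>N_nodes k. \<forall>a\<in>carrier (N_object R v). u (N_incl R p k v a) = h v a)"
    using P h_hom h_comm by (rule N_universal_property)
  obtain u where u: "u \<in> mod_hom R N P"
      "\<And>v a. v \<in> N_nodes k \<Longrightarrow> a \<in> carrier (N_object R v) \<Longrightarrow> u (N_incl R p k v a) = h v a"
    using ex1_implies_ex[OF univ] by blast
  have "u (N_gen R p k j) = G j" if "odd j" "-1 \<le> j" "j \<le> int k" for j
    using u(2)[of "Plain j" \<one>] G[OF that] that by (simp add: N_gen_def h_def N_nodes_def)
  note this[of "-1"] this[of "2 * int s + 1" for s]
  then have "u (N_gen R p k (-1)) = x" "\<And>s. s < r \<Longrightarrow> u (N_gen R p k (2 * int s + 1)) = X s"
    using int_length by (simp_all add: G_def)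
  then show ?thesis using u(1) by blast
qed

lemma N_incl_Plain:
  assumes "odd j" "-1 \<le> j" "j \<le> int k" "a \<in> carrier R"
  shows "N_incl R p k (Plain j) a = a \<odot>\<^bsub>N\<^esub> N_gen R p k j"
proof -
  have "Plain j \<in> N_nodes k" using assms by (simp add: N_nodes_def)
  then have "N_incl R p k (Plain j) \<in> mod_hom R (N_object R (Plain j)) N" by (rule N_incl_mod_hom)
  from mod_homD(3)[OF this, of a \<one>] show ?thesis using assms by (simp add: N_gen_def)
qed

lemma N_incl_Null: "N_incl R p k Null \<zero> = \<zero>\<^bsub>N\<^esub>"
proof -
  have "Null \<in> N_nodes k" by (simp add: N_nodes_def)
  then have "N_incl R p k Null \<in> mod_hom R (N_object R Null) N" by (rule N_incl_mod_hom)
  from mod_hom_zero[OF N_diagram(2)[OF is_cring odd_length] module_N this] show ?thesis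
    by (simp add: zero_module_def)
qed

lemma N_gen_closed: "odd j \<Longrightarrow> -1 \<le> j \<Longrightarrow> j \<le> int k \<Longrightarrow> N_gen R p k j \<in> carrier N"
  unfolding N_gen_def
  by (rule mod_homD(1)[OF N_incl_mod_hom]) (auto simp: N_nodes_def)

lemma N_incl_Primed:
  "odd j \<Longrightarrow> 1 \<le> j \<Longrightarrow> j \<le> int k \<Longrightarrow> a \<in> carrier R \<Longrightarrow>
     N_incl R p k (Primed j) a = N_incl R p k (Plain j) ([j] \<cdot> a)"
  "a \<in> carrier R \<Longrightarrow> N_incl R p k (Primed 1) a = N_incl R p k (Plain (-1)) ([p] \<cdot> a)"
  "odd j \<Longrightarrow> 3 \<le> j \<Longrightarrow> j \<le> int k + 2 \<Longrightarrow> a \<in> carrier R \<Longrightarrow>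
     N_incl R p k (Primed j) a = N_incl R p k (Plain (j - 2)) ([p\<^sup>2] \<cdot> a)"
  "a \<in> carrier R \<Longrightarrow> N_incl R p k (Primed (int k + 2)) a = N_incl R p k Null \<zero>"
  by (rule N_incl_arrow[symmetric]; simp add: N_arrows_def)+

lemma chain_relations_N:
  "chain_relations R p r N (N_gen R p k (-1)) (\<lambda>s. N_gen R p k (2 * int s + 1))"
proof -
  interpret N: module R N by (rule module_N)
  let ?e = "N_gen R p k (-1)" and ?E = "\<lambda>s. N_gen R p k (2 * int s + 1)"
  have E: "?E s \<in> carrier N" if "s < r" for s using that int_length by (intro N_gen_closed) auto
  have e: "?e \<in> carrier N" by (rule N_gen_closed) auto
  \<comment> \<open>Without \<open>One_nat_def\<close>, so that \<open>2 * r - 1\<close> keeps the form in which the rules for \<open>N\<close> are stated.\<close>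
  have "N_incl R p k (Plain 1) ([(1::int)] \<cdot> \<one>) = N_incl R p k (Plain (-1)) ([p] \<cdot> \<one>)"
    using N_incl_Primed(1)[of 1 \<one>] N_incl_Primed(2)[of \<one>] int_length r by simp
  then have "?E 0 = ([p] \<cdot> \<one>) \<odot>\<^bsub>N\<^esub> ?e"
    using N_incl_Plain[of 1 \<one>] N_incl_Plain[of "-1" "[p] \<cdot> \<one>"] E[OF r] r int_length by (simp del: One_nat_def)
  moreover have "([(2 * s + 3)] \<cdot> \<one>) \<odot>\<^bsub>N\<^esub> ?E (Suc s) = ([p\<^sup>2] \<cdot> \<one>) \<odot>\<^bsub>N\<^esub> ?E s" if s: "Suc s < r" for s
  proof -
    let ?j = "2 * int s + 3"
    have j: "odd ?j" "1 \<le> ?j" "3 \<le> ?j" "?j \<le> int k" "?j \<le> int k + 2" using s int_length by auto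
    have "N_incl R p k (Plain ?j) ([?j] \<cdot> \<one>) = N_incl R p k (Plain (?j - 2)) ([p\<^sup>2] \<cdot> \<one>)"
      using N_incl_Primed(1)[OF j(1,2,4) one_closed] N_incl_Primed(3)[OF j(1,3,5) one_closed] by simp
    moreover have "[?j] \<cdot> \<one> = [(2 * s + 3)] \<cdot> \<one>"
      using add_pow_int_ge[of ?j R \<one>] by (simp add: nat_add_distrib nat_mult_distrib)
    moreover have "N_incl R p k (Plain ?j) ([(2 * s + 3)] \<cdot> \<one>) = ([(2 * s + 3)] \<cdot> \<one>) \<odot>\<^bsub>N\<^esub> N_gen R p k ?j"
      using j by (intro N_incl_Plain) auto
    moreover have "N_incl R p k (Plain (?j - 2)) ([p\<^sup>2] \<cdot> \<one>) = ([p\<^sup>2] \<cdot> \<one>) \<odot>\<^bsub>N\<^esub> N_gen R p k (?j - 2)"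
      using j by (intro N_incl_Plain) auto
    moreover have "?j = 2 * int (Suc s) + 1" "?j - 2 = 2 * int s + 1" by simp_all
    ultimately show ?thesis by (simp only:)
  qed
  moreover have "([p\<^sup>2] \<cdot> \<one>) \<odot>\<^bsub>N\<^esub> ?E (r - 1) = \<zero>\<^bsub>N\<^esub>"
  proof -
    let ?j = "int k + 2"
    have j: "odd ?j" "3 \<le> ?j" using int_length r by auto
    have "N_incl R p k (Plain (?j - 2)) ([p\<^sup>2] \<cdot> \<one>) = \<zero>\<^bsub>N\<^esub>"
      using N_incl_Primed(3)[OF j order_refl one_closed, symmetric] N_incl_Primed(4)[OF one_closed] N_incl_Null
      by (rule trans[OF _ trans])
    moreover have "N_incl R p k (Plain (int k)) ([p\<^sup>2] \<cdot> \<one>) = ([p\<^sup>2] \<cdot> \<one>) \<odot>\<^bsub>N\<^esub> N_gen R p k (int k)"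
      using int_length r by (intro N_incl_Plain) auto
    moreover have "int k = 2 * int (r - 1) + 1" "?j - 2 = int k" using int_length r by auto
    ultimately show ?thesis by (simp only:)
  qed
  ultimately show ?thesis using e E unfolding chain_relations_def by blast
qed

lemma N_mod_hom_eqI:
  assumes P: "module R P" and f: "f \<in> mod_hom R N P" and g: "g \<in> mod_hom R N P"
    and e: "f (N_gen R p k (-1)) = g (N_gen R p k (-1))"
    and E: "\<And>s. s < r \<Longrightarrow> f (N_gen R p k (2 * int s + 1)) = g (N_gen R p k (2 * int s + 1))"
    and z: "z \<in> carrier N"
  shows "f z = g z"
proof -
  have fg_gen: "f (N_gen R p k j) = g (N_gen R p k j)" if "odd j" "-1 \<le> j" "j \<le> int k" for j
  proof (cases "j = -1")
    case False
    define s where "s = nat (j div 2)"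
    have "j = 2 * int s + 1" using False that by (auto simp: s_def elim!: oddE)
    moreover from this have "s < r" using that int_length by linarith
    ultimately show ?thesis using E by simp
  qed (simp only: e)
  have plain: "f (N_incl R p k (Plain j) a) = g (N_incl R p k (Plain j) a)"
    if "odd j" "-1 \<le> j" "j \<le> int k" "a \<in> carrier R" for j a
    using fg_gen[OF that(1-3)] that mod_homD(3)[OF f that(4) N_gen_closed[OF that(1-3)]]
      mod_homD(3)[OF g that(4) N_gen_closed[OF that(1-3)]]
    by (simp only: N_incl_Plain[OF that])
  have null: "f (N_incl R p k Null \<zero>) = g (N_incl R p k Null \<zero>)"
    unfolding N_incl_Null mod_hom_zero[OF module_N P f] mod_hom_zero[OF module_N P g] ..
  have agree: "f (N_incl R p k v a) = g (N_incl R p k v a)"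
    if v: "v \<in> N_nodes k" and a: "a \<in> carrier (N_object R v)" for v a
  proof (cases v)
    case Null
    then show ?thesis using null a by (simp add: zero_module_def)
  next
    case (Plain j)
    then have j: "odd j" "-1 \<le> j" "j \<le> int k" using v by (simp_all add: N_nodes_def)
    show ?thesis unfolding Plain using a Plain by (intro plain j) simp
  next
    case (Primed j)
    then have j: "odd j" "1 \<le> j" "j \<le> int k + 2" using v by (auto simp: N_nodes_def)
    have a: "a \<in> carrier R" using a Primed by simp
    show ?thesis
    proof (cases "j = int k + 2")
      case True
      then show ?thesis using null a Primed by (simp only: N_incl_Primed(4))
    next
      case False
      then have jk: "j \<le> int k" using j unfolding int_length by (auto elim!: oddE)
      have "[j] \<cdot> a \<in> carrier R" using a by simp
      then show ?thesis using plain[OF j(1) _ jk] j Primed N_incl_Primed(1)[OF j(1,2) jk a] by simp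
    qed
  qed
  have hom: "(\<lambda>a. f (N_incl R p k v a)) \<in> mod_hom R (N_object R v) P" if "v \<in> N_nodes k" for v
    by (rule mod_hom_comp[OF N_incl_mod_hom[OF that] f])
  have comm: "f (N_incl R p k t (m a)) = f (N_incl R p k s a)"
    if "(s, t, m) \<in> N_arrows R p k" "a \<in> carrier (N_object R s)" for s t m a
    using N_incl_arrow[OF that] by simp
  have inc: "N_incl R p k v a \<in> carrier N" if "v \<in> N_nodes k" "a \<in> carrier (N_object R v)" for v a
    using mod_homD(1)[OF N_incl_mod_hom[OF that(1)] that(2)] .
  have univ: "\<exists>!u. u \<in> mod_hom R N P \<inter> extensional (carrier N) \<and>
      (\<forall>v\<in>N_nodes k. \<forall>a\<in>carrier (N_object R v). u (N_incl R p k v a) = f (N_incl R p k v a))"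
    using P hom comm by (rule N_universal_property)
  have rf: "restrict f (carrier N) \<in> mod_hom R N P \<inter> extensional (carrier N) \<and>
      (\<forall>v\<in>N_nodes k. \<forall>a\<in>carrier (N_object R v). restrict f (carrier N) (N_incl R p k v a) = f (N_incl R p k v a))"
    by (simp add: mod_hom_restrict[OF module_N f] inc del: One_nat_def)
  have rg: "restrict g (carrier N) \<in> mod_hom R N P \<inter> extensional (carrier N) \<and>
      (\<forall>v\<in>N_nodes k. \<forall>a\<in>carrier (N_object R v). restrict g (carrier N) (N_incl R p k v a) = f (N_incl R p k v a))"
    by (simp add: mod_hom_restrict[OF module_N g] inc agree del: One_nat_def)
  have "restrict f (carrier N) = restrict g (carrier N)"
    by (rule ex1E[OF univ]) (metis rf rg)
  then show ?thesis using z by (metis restrict_apply')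
qed

end

end

section \<open>The isomorphism\<close>

text \<open>Since \<^const>\<open>expansion\<close> matches the two sets of relations in every module, each side receives a
  homomorphism from the other by its universal property. The composites fix generators: on \<open>N\<^sub>k\<close> by
  construction, on the direct sum because an expansion determines its coefficients \<open>Y\<close>.\<close>

theorem (in chain_coefficients) N_module_isomorphic_torsion_sum:
  "module_isomorphic R (N_module R p (2 * r - 1)) (torsion_sum R q r)"
proof -
  let ?N = "N_module R p (2 * r - 1)" and ?T = "torsion_sum R q r"
  let ?e = "N_gen R p (2 * r - 1) (-1)" and ?E = "\<lambda>s. N_gen R p (2 * r - 1) (2 * int s + 1)"
  let ?y = "torsion_sum_fst_gen R q r" and ?Y = "torsion_sum_snd_gen R q r"
  have N: "module R ?N" and T: "module R ?T" using r_pos by (rule module_N, rule module_torsion_sum)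
  have relT: "torsion_relations R q r ?T ?y ?Y" using r_pos by (rule torsion_relations_torsion_sum)
  then have y: "?y \<in> carrier ?T" and Y: "\<And>s. s < r \<Longrightarrow> ?Y s \<in> carrier ?T"
    by (simp_all only: torsion_relations_def)
  have relN: "chain_relations R p r ?N ?e ?E" using r_pos by (rule chain_relations_N)
  then have e: "?e \<in> carrier ?N" and E: "\<And>s. s < r \<Longrightarrow> ?E s \<in> carrier ?N"
    by (simp_all only: chain_relations_def)
  obtain W where W: "\<And>s. s < r \<Longrightarrow> W s \<in> carrier ?N"
      and EW: "\<And>s. s < r \<Longrightarrow> ?E s = expansion ?N \<alpha> \<beta> ?e W s"
  proof -
    have "\<exists>W. (\<forall>s<r. W s \<in> carrier ?N) \<and> (\<forall>s<r. ?E s = expansion ?N \<alpha> \<beta> ?e W s)"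
      using N e E by (rule expansion_surj)
    then show thesis using that by blast
  qed
  have "chain_relations R p r ?N ?e ?E \<longleftrightarrow> torsion_relations R q r ?N ?e W"
    using N e W EW by (rule chain_relations_iff_torsion_relations[where X = ?E and Y = W])
  then have "torsion_relations R q r ?N ?e W" using relN by (rule iffD1)
  then have "\<exists>g\<in>mod_hom R ?T ?N. g ?y = ?e \<and> (\<forall>s<r. g (?Y s) = W s)"
    by (rule torsion_sum_lift[OF r_pos N])
  then obtain g where g: "g \<in> mod_hom R ?T ?N" "g ?y = ?e" "\<And>s. s < r \<Longrightarrow> g (?Y s) = W s"
    by blast
  have "chain_relations R p r ?T ?y (expansion ?T \<alpha> \<beta> ?y ?Y) \<longleftrightarrow> torsion_relations R q r ?T ?y ?Y"
    using T y Y refl by (rule chain_relations_iff_torsion_relations)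
  then have "chain_relations R p r ?T ?y (expansion ?T \<alpha> \<beta> ?y ?Y)" using relT by (rule iffD2)
  then have "\<exists>f\<in>mod_hom R ?N ?T. f ?e = ?y \<and> (\<forall>s<r. f (?E s) = expansion ?T \<alpha> \<beta> ?y ?Y s)"
    by (rule N_lift[OF r_pos T])
  then obtain f where f: "f \<in> mod_hom R ?N ?T" "f ?e = ?y"
      "\<And>s. s < r \<Longrightarrow> f (?E s) = expansion ?T \<alpha> \<beta> ?y ?Y s"
    by blast
  have fc: "f z \<in> carrier ?T" if "z \<in> carrier ?N" for z using that by (rule mod_homD(1)[OF f(1)])
  have cong: "expansion ?N \<alpha> \<beta> ?e (\<lambda>m. g (?Y m)) s = expansion ?N \<alpha> \<beta> ?e W s" if "s < r" for s
  proof -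
    interpret N: module R ?N by (rule N)
    show ?thesis unfolding expansion_def using that g(3) W \<beta>_closed
      by (intro arg_cong2[where f = "add ?N"] refl N.M.finsum_cong') (auto intro!: N.smult_closed simp del: One_nat_def)
  qed
  show ?thesis
  proof (rule module_isomorphicI[OF f(1) g(1)])
    fix z assume z: "z \<in> carrier ?N"
    show "g (f z) = z"
    proof (rule N_mod_hom_eqI[OF r_pos N mod_hom_comp[OF f(1) g(1)] mod_hom_ident _ _ z])
      show "g (f ?e) = ?e" by (simp only: f(2) g(2))
      show "g (f (?E s)) = ?E s" if s: "s < r" for s
      proof -
        have "g (expansion ?T \<alpha> \<beta> ?y ?Y s) = expansion ?N \<alpha> \<beta> (g ?y) (\<lambda>m. g (?Y m)) s"
          using T N g(1) y Y s by (rule mod_hom_expansion)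
        then show ?thesis using cong[OF s] by (simp only: f(3)[OF s] g(2) EW[OF s, symmetric])
      qed
    qed
  next
    have fW: "expansion ?T \<alpha> \<beta> ?y (\<lambda>m. f (W m)) s = expansion ?T \<alpha> \<beta> ?y ?Y s" if s: "s < r" for s
    proof -
      have "f (expansion ?N \<alpha> \<beta> ?e W s) = expansion ?T \<alpha> \<beta> (f ?e) (\<lambda>m. f (W m)) s"
        using N T f(1) e W s by (rule mod_hom_expansion)
      then show ?thesis by (simp only: f(2) f(3)[OF s] EW[OF s, symmetric])
    qed
    fix z assume z: "z \<in> carrier ?T"
    show "f (g z) = z"
    proof (rule torsion_sum_mod_hom_eqI[OF r_pos T mod_hom_comp[OF g(1) f(1)] mod_hom_ident _ _ z])
      show "f (g ?y) = ?y" by (simp only: f(2) g(2))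
      show "f (g (?Y s)) = ?Y s" if s: "s < r" for s
      proof -
        have "f (W s) = ?Y s"
          by (rule expansion_inject[where Y = "\<lambda>m. f (W m)" and Z = ?Y, OF T y fc[OF W] Y fW s])
        then show ?thesis by (simp only: g(3)[OF s])
      qed
    qed
  qed
qed

lemma of_nat_localized: "Factorial_Ring.prime p \<Longrightarrow> of_nat n \<in> carrier (localized_integers p)"
  by (rule localized_integersI) (simp_all add: p_valuation_of_nat)

text \<open>Integers thus act on \<open>R\<close> through \<open>\<phi>\<close>, so that identities and divisibilities between rational
  numbers that are integral at \<open>p\<close> can be transported to \<open>R\<close>.\<close>

lemma ring_hom_localized_of_nat:
  fixes R :: "('a, 'm) ring_scheme" (structure)
  assumes p: "Factorial_Ring.prime p" and R: "cring R" and \<phi>: "\<phi> \<in> ring_hom (localized_integers p) R"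
  shows "\<phi> (of_nat n) = [n] \<cdot> \<one>"
proof -
  interpret cring R by (rule R)
  note cl = of_nat_localized[OF p]
  have add: "\<phi> (x + y) = \<phi> x \<oplus> \<phi> y" if "x \<in> carrier (localized_integers p)" "y \<in> carrier (localized_integers p)" for x y
    using ring_hom_add[OF \<phi> that] by (simp add: localized_integers_def)
  have one: "\<phi> 1 = \<one>" using ring_hom_one[OF \<phi>] by (simp add: localized_integers_def)
  have zero: "\<phi> 0 \<in> carrier R" "\<phi> 0 \<oplus> \<phi> 0 = \<phi> 0"
    using add[of 0 0] ring_hom_closed[OF \<phi>, of 0] cl[of 0] by auto
  show ?thesis
  proof (induction n)
    case 0
    then show ?case using zero by (simp add: add.l_cancel_one)
  next
    case (Suc n)
    then show ?case using add[OF cl[of n] cl[of 1]] one by (simp add: add.commute)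
  qed
qed

theorem corollary5p6:
  fixes R :: "('a, 'm) ring_scheme" and \<phi> :: "rat \<Rightarrow> 'a" and p i :: nat
  assumes "Factorial_Ring.prime p" and "odd p"
    and "cring R"
    and "\<phi> \<in> ring_hom (localized_integers p) R"
    and "\<forall>x\<in>carrier R. [p] \<cdot>\<^bsub>R\<^esub> x = \<zero>\<^bsub>R\<^esub> \<longrightarrow> x = \<zero>\<^bsub>R\<^esub>"
    and "odd i" and "i > 1" and "int i \<in> Z2 p"
  shows "module_isomorphic R (N_module R p (i - 2))
    (pair_sum (cyclic_module R (p ^ nat (a_val p i)))
       (direct_sum {n. odd n \<and> n \<le> i - 2} (cyclic_module R)))"
proof -
  interpret cring R by fact
  note p = assms(1,2) and \<phi> = assms(4) and Z2 = assms(8)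
  let ?L = "localized_integers p" and ?q = "p ^ nat (a_val p i)"
  let ?\<alpha> = "\<lambda>s. \<phi> (A_num p (2 * s + 1))" and ?\<beta> = "\<lambda>s. \<phi> (B_num p (2 * s))"
  define r where "r = i div 2"
  have i: "i = 2 * r + 1" and r: "r > 0" using assms(6,7) by (auto simp: r_def elim!: oddE)
  have closed: "\<phi> x \<in> carrier R" if "x \<in> carrier ?L" for x
    using ring_hom_closed[OF \<phi> that] .
  have mult: "\<phi> (x * y) = \<phi> x \<otimes>\<^bsub>R\<^esub> \<phi> y" if "x \<in> carrier ?L" "y \<in> carrier ?L" for x y
    using ring_hom_mult[OF \<phi> that] by (simp add: localized_integers_def)
  have one: "\<phi> 1 = \<one>\<^bsub>R\<^esub>" using ring_hom_one[OF \<phi>] by (simp add: localized_integers_def)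
  note nat = ring_hom_localized_of_nat[OF p(1) assms(3) \<phi>, symmetric]
  note nat_closed = of_nat_localized[OF p(1)]
  have unit: "\<phi> x \<in> Units R" if "x \<in> carrier ?L" "inverse x \<in> carrier ?L" "x \<noteq> 0" for x
  proof -
    have "\<phi> (inverse x) \<otimes>\<^bsub>R\<^esub> \<phi> x = \<one>\<^bsub>R\<^esub>" using mult[OF that(2,1)] that(3) one by simp
    then show ?thesis using closed[OF that(1)] closed[OF that(2)]
      by (auto simp: Units_def m_comm intro!: bexI[of _ "\<phi> (inverse x)"])
  qed
  interpret chain_coefficients R p ?q r ?\<alpha> ?\<beta>
  proof
    fix s
    show "?\<alpha> s \<in> carrier R" by (rule closed[OF A_num_localized[OF p]])
    show "?\<beta> s \<in> carrier R" by (rule closed[OF B_num_localized[OF p]])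
    show "?\<alpha> 0 = [p] \<cdot>\<^bsub>R\<^esub> \<one>\<^bsub>R\<^esub>" by (simp add: nat)
    show "?\<beta> 0 = \<one>\<^bsub>R\<^esub>" by (simp add: one)
    have "A_num p (2 * Suc s + 1) = A_num p (Suc (Suc (2 * s + 1)))" by simp
    also have "of_nat (2 * s + 3) * \<dots> = of_nat (p\<^sup>2) * A_num p (2 * s + 1)"
      unfolding A_num.simps(3) by (simp add: field_simps)
    finally show "([(2 * s + 3)] \<cdot>\<^bsub>R\<^esub> \<one>\<^bsub>R\<^esub>) \<otimes>\<^bsub>R\<^esub> ?\<alpha> (Suc s) = ([p\<^sup>2] \<cdot>\<^bsub>R\<^esub> \<one>\<^bsub>R\<^esub>) \<otimes>\<^bsub>R\<^esub> ?\<alpha> s"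
      unfolding nat by (simp only: mult[OF nat_closed A_num_localized[OF p], symmetric])
    have "B_num p (2 * Suc s) = B_num p (Suc (Suc (2 * s)))" by simp
    also have "of_nat (2 * Suc s) * \<dots> = of_nat (p\<^sup>2) * B_num p (2 * s)"
      unfolding B_num.simps(3) by (simp add: field_simps)
    finally show "([(2 * Suc s)] \<cdot>\<^bsub>R\<^esub> \<one>\<^bsub>R\<^esub>) \<otimes>\<^bsub>R\<^esub> ?\<beta> (Suc s) = ([p\<^sup>2] \<cdot>\<^bsub>R\<^esub> \<one>\<^bsub>R\<^esub>) \<otimes>\<^bsub>R\<^esub> ?\<beta> s"
      unfolding nat by (simp only: mult[OF nat_closed B_num_localized[OF p], symmetric])
  next
    show "r > 0" by (rule r)
  next
    show "[(2 * r + 1)] \<cdot>\<^bsub>R\<^esub> \<one>\<^bsub>R\<^esub> \<in> Units R"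
      unfolding nat i[symmetric]
      using assms(7) by (intro unit nat_closed inverse_localized[OF p] Z2_not_dvd[OF p Z2]) simp
  next
    obtain u where u: "u \<in> carrier ?L" "inverse u \<in> carrier ?L" "u \<noteq> 0"
        "A_num p (2 * r + 1) = u * of_nat (p ^ nat (a_val p (2 * r + 1)))"
      by (rule A_num_associated_power[OF p])
    show "\<exists>u\<in>Units R. ?\<alpha> r = u \<otimes>\<^bsub>R\<^esub> ([?q] \<cdot>\<^bsub>R\<^esub> \<one>\<^bsub>R\<^esub>)"
      by (rule bexI[OF _ unit[OF u(1-3)]]) (simp only: nat i mult[OF u(1) nat_closed] u(4))
  next
    fix m assume m: "m < r"
    then have "i - (2 * m + 1) = 2 * (r - m)" "odd (2 * m + 1)" "2 * m + 1 < i"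
      unfolding i by simp_all
    then obtain c where c: "c \<in> carrier ?L" "B_num p (2 * (r - m)) = of_nat (2 * m + 1) * c"
      using Z2_B_num_dvd[OF p Z2] by metis
    show "\<exists>c\<in>carrier R. ?\<beta> (r - m) = c \<otimes>\<^bsub>R\<^esub> ([(2 * m + 1)] \<cdot>\<^bsub>R\<^esub> \<one>\<^bsub>R\<^esub>)"
      by (rule bexI[OF _ closed[OF c(1)]])
         (simp only: nat c(2) mult[OF nat_closed c(1)] m_comm closed nat_closed c(1))
  qed
  have "i - 2 = 2 * r - 1" using i by simp
  then show ?thesis using N_module_isomorphic_torsion_sum by (simp only:)
qed

end
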